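(* Let $H$ be a $k$-dimensional linear subspace of $\mathbb{R}^{n+1}$ that contains the centroid of $S$. Then $$\operatorname{vol}_{k-1}(H\cap S)\le\frac{\sqrt{n+1}}{(k-1)!}\,\frac{\left(\sqrt{k}\right)^{\frac{k}{n+1}}}{\sqrt{n+1}}.$$ If additionally $\operatorname{dist}(H,e_j)^2\le\frac{n+1-k}{n+2-k}$ for all $j=1,\dots,n+1$, then $$\operatorname{vol}_{k-1}(H\cap S)\le\frac{\sqrt{n+1}}{(k-1)!}\,\frac{1}{\sqrt{n+2-k}}$$ holds. In this (second) case the estimate is sharp, i.e. equality is attained for some $k$-dimensional subspace $H$ containing the centroid of $S$ and satisfying the additional distance condition.
   Context: $S:=\{x\in\mathbb{R}^{n+1}\mid \sum_{j=1}^{n+1}x_j=1,\ x_j\ge 0\}$ is the regular $n$-simplex embedded in $\mathbb{R}^{n+1}$; its centroid is $\left(\frac1{n+1},\dots,\frac1{n+1}\right)$ and its vertices are the standard basis vectors $e_1,\dots,e_{n+1}$. $\operatorname{vol}_{k-1}$ is the $(k-1)$-dimensional Lebesgue volume within the affine subspace $H\cap\{\sum_j x_j=1\}$. $\operatorname{dist}$ denotes Euclidean distance, $\operatorname{dist}(H,x):=\inf\{\|h-x\|\mid h\in H\}$. *)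

theory Defs
  imports "HOL-Analysis.Analysis"
begin

section \<open>Lebesgue measure on affine subspaces\<close>

definition orthonormal_frame :: "'a::euclidean_space set \<Rightarrow> 'a \<Rightarrow> 'a set \<Rightarrow> bool" where
  "orthonormal_frame A a B \<longleftrightarrow>
     pairwise orthogonal B \<and> (\<forall>b\<in>B. norm b = 1) \<and> A = (\<lambda>v. a + v) ` span B"

text \<open>
  The image of the \<open>card B\<close>-dimensional Lebesgue measure under the parametrisation
  \<open>f \<mapsto> a + (\<Sum>b\<in>B. f b *\<^sub>R b)\<close>; for \<open>a = 0\<close> and \<open>B = Basis\<close> this is the library's \<open>lborel\<close>.
  For \<open>B = {}\<close> it is the point mass at \<open>a\<close>.
\<close>
definition frame_lborel :: "'a::euclidean_space \<Rightarrow> 'a set \<Rightarrow> 'a measure" where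
  "frame_lborel a B =
     distr (\<Pi>\<^sub>M b\<in>B. (lborel :: real measure)) borel (\<lambda>f. a + (\<Sum>b\<in>B. f b *\<^sub>R b))"

text \<open>
  By \<open>affine_lborel_eq_frame_lborel\<close> below the choice of the frame is irrelevant.
\<close>
definition affine_lborel :: "'a::euclidean_space set \<Rightarrow> 'a measure" where
  "affine_lborel A =
     (let p = (SOME p. orthonormal_frame A (fst p) (snd p)) in frame_lborel (fst p) (snd p))"

definition affine_vol :: "'a::euclidean_space set \<Rightarrow> 'a set \<Rightarrow> real" where
  "affine_vol A X = measure (completion (affine_lborel A)) X"

section \<open>The simplex\<close>

text \<open>
  The ambient space has coordinates indexed by \<open>'n\<close> with \<open>CARD('n) = n + 1\<close>. If \<open>H\<close> is a
  \<open>k\<close>-dimensional subspace containing the centroid, then \<open>section_vol H\<close> is a \<open>(k - 1)\<close>-dimensional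
  volume, by \<open>aff_dim_section\<close> below.
\<close>

definition sum_one_hyperplane :: "(real ^ 'n::finite) set" where
  "sum_one_hyperplane = {x. (\<Sum>j\<in>UNIV. x $ j) = 1}"

definition regular_simplex :: "(real ^ 'n::finite) set" where
  "regular_simplex = {x. (\<Sum>j\<in>UNIV. x $ j) = 1 \<and> (\<forall>j. x $ j \<ge> 0)}"

definition simplex_centroid :: "real ^ 'n::finite" where
  "simplex_centroid = (\<chi> j. 1 / real CARD('n))"

definition section_vol :: "(real ^ 'n::finite) set \<Rightarrow> real" where
  "section_vol H = affine_vol (H \<inter> sum_one_hyperplane) (H \<inter> regular_simplex)"

section \<open>Well-definedness\<close>

lemma orthonormal_frame_exists:
  fixes A :: "'a::euclidean_space set"
  assumes "affine A" "A \<noteq> {}"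
  shows "\<exists>a B. orthonormal_frame A a B"
proof -
  obtain a where a: "a \<in> A" using assms by blast
  define V where "V = (\<lambda>x. - a + x) ` A"
  have V: "subspace V"
    using affine_diffs_subspace[OF assms(1) a] by (simp add: V_def)
  obtain B where B: "B \<subseteq> V" "pairwise orthogonal B" "\<And>x. x \<in> B \<Longrightarrow> norm x = 1" "span B = V"
    using orthonormal_basis_subspace[OF V] by metis
  have "A = (\<lambda>v. a + v) ` V" by (simp add: V_def image_image)
  with B show ?thesis unfolding orthonormal_frame_def by metis
qed

context
  fixes B :: "'a::euclidean_space set"
  assumes orth: "pairwise orthogonal B" and unit: "\<And>b. b \<in> B \<Longrightarrow> norm b = 1"
begin

lemma frame_independent: "independent B"
  using pairwise_orthogonal_independent[OF orth] unit by fastforce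

lemma frame_finite: "finite B"
  using frame_independent independent_imp_finite by blast

lemma frame_span: "x \<in> span B \<longleftrightarrow> (\<exists>c. x = (\<Sum>b\<in>B. c b *\<^sub>R b))"
  using span_finite[OF frame_finite] by auto

lemma frame_norm: "(norm (\<Sum>b\<in>B. c b *\<^sub>R b))\<^sup>2 = (\<Sum>b\<in>B. (c b)\<^sup>2)"
proof -
  have "(norm (\<Sum>b\<in>B. c b *\<^sub>R b))\<^sup>2 = (\<Sum>b\<in>B. (norm (c b *\<^sub>R b))\<^sup>2)"
    using frame_finite orth
    by (intro norm_sum_Pythagorean) (auto simp: pairwise_def orthogonal_def)
  then show ?thesis by (simp add: unit)
qed

lemma frame_measurable[measurable]:
  "(\<lambda>f. a + (\<Sum>b\<in>B. f b *\<^sub>R b)) \<in> borel_measurable (\<Pi>\<^sub>M b\<in>B. (lborel :: real measure))"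
  by measurable

lemma sets_frame_lborel[simp, measurable_cong]: "sets (frame_lborel a B) = sets borel"
  by (simp add: frame_lborel_def)

lemma PiM_lborel_reflect:
  "distr (\<Pi>\<^sub>M b\<in>B. (lborel :: real measure)) (\<Pi>\<^sub>M b\<in>B. lborel) (\<lambda>f. \<lambda>b\<in>B. c b - f b)
     = (\<Pi>\<^sub>M b\<in>B. lborel)" (is "?D = ?P")
proof -
  interpret product_sigma_finite "\<lambda>_::'a. lborel :: real measure" by standard
  show ?thesis
  proof (rule PiM_eqI[OF frame_finite])
    show "sets ?D = sets ?P" by simp
    fix A :: "'a \<Rightarrow> real set" assume A: "\<And>i. i \<in> B \<Longrightarrow> A i \<in> sets lborel"
    have eq: "(\<lambda>f. \<lambda>b\<in>B. c b - f b) -` Pi\<^sub>E B A \<inter> space ?P = Pi\<^sub>E B (\<lambda>b. (\<lambda>t. c b - t) -` A b)"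
      by (auto simp: space_PiM PiE_iff)
    have refl: "emeasure lborel ((\<lambda>t. c b - t) -` A b) = emeasure lborel (A b)" if "b \<in> B" for b
    proof -
      have [measurable]: "A b \<in> sets borel" using A[OF that] by simp
      have [measurable]: "(+) (c b) -` A b \<in> sets borel"
        using measurable_sets[of "(+) (c b)" borel borel "A b"] by simp
      have "emeasure (lborel :: real measure) (A b)
          = emeasure (distr lborel borel ((+) (c b))) (A b)" by (simp add: lborel_distr_plus)
      also have "\<dots> = emeasure (distr lborel borel uminus) ((\<lambda>t. c b + t) -` A b)"
        by (subst emeasure_distr) (auto simp: lborel_distr_uminus)
      also have "\<dots> = emeasure lborel (uminus -` ((\<lambda>t. c b + t) -` A b))"
        by (subst emeasure_distr) auto
      finally show ?thesis by (simp add: vimage_def)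
    qed
    have "emeasure ?D (Pi\<^sub>E B A) = emeasure ?P (Pi\<^sub>E B (\<lambda>b. (\<lambda>t. c b - t) -` A b))"
      using A frame_finite by (subst emeasure_distr) (auto simp: eq intro!: sets_PiM_I_finite)
    also have "\<dots> = (\<Prod>b\<in>B. emeasure lborel ((\<lambda>t. c b - t) -` A b))"
    proof (rule emeasure_PiM[OF frame_finite])
      fix b assume "b \<in> B"
      then have [measurable]: "A b \<in> sets borel" using A by simp
      show "(\<lambda>t. c b - t) -` A b \<in> sets lborel"
        using measurable_sets[of "\<lambda>t. c b - t" borel borel "A b"] by simp
    qed
    finally show "emeasure ?D (Pi\<^sub>E B A) = (\<Prod>i\<in>B. emeasure lborel (A i))"
      by (simp add: refl)
  qed
qed

lemma nn_integral_frame_lborel: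
  "f \<in> borel_measurable borel \<Longrightarrow> (\<integral>\<^sup>+x. f x \<partial>frame_lborel a B)
     = (\<integral>\<^sup>+c. f (a + (\<Sum>b\<in>B. c b *\<^sub>R b)) \<partial>(\<Pi>\<^sub>M b\<in>B. (lborel :: real measure)))"
  unfolding frame_lborel_def by (rule nn_integral_distr) measurable

lemma frame_lborel_reflect:
  assumes [measurable]: "f \<in> borel_measurable borel" and x: "x \<in> span B"
  shows "(\<integral>\<^sup>+y. f (x - y) \<partial>frame_lborel 0 B) = (\<integral>\<^sup>+y. f y \<partial>frame_lborel 0 B)"
proof -
  obtain c where c: "x = (\<Sum>b\<in>B. c b *\<^sub>R b)" using x frame_span by blast
  let ?P = "\<Pi>\<^sub>M b\<in>B. (lborel :: real measure)"
  have "(\<integral>\<^sup>+y. f y \<partial>frame_lborel 0 B) = (\<integral>\<^sup>+g. f (\<Sum>b\<in>B. g b *\<^sub>R b) \<partial>?P)"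
    by (simp add: nn_integral_frame_lborel)
  also have "\<dots> = (\<integral>\<^sup>+g. f (\<Sum>b\<in>B. g b *\<^sub>R b) \<partial>distr ?P ?P (\<lambda>f. \<lambda>b\<in>B. c b - f b))"
    by (simp add: PiM_lborel_reflect)
  also have "\<dots> = (\<integral>\<^sup>+g. f (\<Sum>b\<in>B. (c b - g b) *\<^sub>R b) \<partial>?P)"
  proof (subst nn_integral_distr)
    show "(\<lambda>f. \<lambda>b\<in>B. c b - f b) \<in> ?P \<rightarrow>\<^sub>M ?P"
      by (rule measurable_restrict) simp
    show "(\<lambda>g. f (\<Sum>b\<in>B. g b *\<^sub>R b)) \<in> borel_measurable (distr ?P ?P (\<lambda>f. \<lambda>b\<in>B. c b - f b))"
      using frame_measurable[of 0] by simp
  qed (simp cong: sum.cong)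
  also have "\<dots> = (\<integral>\<^sup>+g. f (x - (\<Sum>b\<in>B. g b *\<^sub>R b)) \<partial>?P)"
    by (simp add: c scaleR_diff_left sum_subtractf)
  also have "\<dots> = (\<integral>\<^sup>+y. f (x - y) \<partial>frame_lborel 0 B)"
    by (subst nn_integral_frame_lborel) auto
  finally show ?thesis by simp
qed

lemma frame_lborel_shift:
  assumes [measurable]: "f \<in> borel_measurable borel" and x: "x \<in> span B"
  shows "(\<integral>\<^sup>+y. f (x + y) \<partial>frame_lborel 0 B) = (\<integral>\<^sup>+y. f y \<partial>frame_lborel 0 B)"
  using frame_lborel_reflect[of "\<lambda>y. f (x + y)" 0] frame_lborel_reflect[of f x] x
  by (simp add: span_zero)

lemma AE_frame_lborel: "AE x in frame_lborel 0 B. x \<in> span B"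
proof -
  have [measurable]: "span B \<in> sets borel" by (simp add: borel_closed closed_subspace)
  show ?thesis unfolding frame_lborel_def
    by (subst AE_distr_iff) (auto simp: span_sum span_scale span_base)
qed

lemma sigma_finite_frame_lborel: "sigma_finite_measure (frame_lborel 0 B)"
proof
  interpret product_sigma_finite "\<lambda>_::'a. lborel :: real measure" by standard
  define K where "K n = cball (0::'a) (real n)" for n
  have "emeasure (frame_lborel 0 B) (K n) \<noteq> \<infinity>" for n
  proof -
    let ?P = "\<Pi>\<^sub>M b\<in>B. (lborel :: real measure)"
    have "emeasure (frame_lborel 0 B) (K n)
        = emeasure ?P ((\<lambda>f. 0 + (\<Sum>b\<in>B. f b *\<^sub>R b)) -` K n \<inter> space ?P)"
      unfolding frame_lborel_def K_def by (rule emeasure_distr) auto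
    also have "\<dots> \<le> emeasure ?P (Pi\<^sub>E B (\<lambda>_. {- real n..real n}))"
    proof (rule emeasure_mono)
      show "(\<lambda>f. 0 + (\<Sum>b\<in>B. f b *\<^sub>R b)) -` K n \<inter> space ?P \<subseteq> Pi\<^sub>E B (\<lambda>_. {- real n..real n})"
      proof
        fix f assume f: "f \<in> (\<lambda>f. 0 + (\<Sum>b\<in>B. f b *\<^sub>R b)) -` K n \<inter> space ?P"
        have "f b \<in> {- real n..real n}" if "b \<in> B" for b
        proof -
          have "(f b)\<^sup>2 \<le> (\<Sum>b\<in>B. (f b)\<^sup>2)"
            using that frame_finite by (intro member_le_sum) auto
          also have "\<dots> = (norm (\<Sum>b\<in>B. f b *\<^sub>R b))\<^sup>2" by (simp add: frame_norm)
          also have "\<dots> \<le> (real n)\<^sup>2" using f by (intro power_mono) (auto simp: K_def)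
          finally have "\<bar>f b\<bar> \<le> real n" by (simp add: abs_le_square_iff[symmetric])
          then show ?thesis by auto
        qed
        then show "f \<in> Pi\<^sub>E B (\<lambda>_. {- real n..real n})" using f by (auto simp: space_PiM PiE_iff)
      qed
    qed (auto intro!: sets_PiM_I_finite frame_finite)
    also have "\<dots> = (\<Prod>b\<in>B. emeasure lborel {- real n..real n})"
      by (rule emeasure_PiM[OF frame_finite]) auto
    also have "\<dots> < \<infinity>" by (auto simp: ennreal_power ennreal_power[symmetric] power_less_top_ennreal)
    finally show ?thesis by simp
  qed
  moreover have "(\<Union>n. K n) = UNIV"
    unfolding K_def by (auto simp: real_arch_simple)
  ultimately show "\<exists>A. countable A \<and> A \<subseteq> sets (frame_lborel 0 B) \<and>
      \<Union> A = space (frame_lborel 0 B) \<and> (\<forall>a\<in>A. emeasure (frame_lborel 0 B) a \<noteq> \<infinity>)"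
    by (intro exI[of _ "range K"]) (auto simp: K_def frame_lborel_def)
qed

lemma nn_integral_frame_gaussian:
  "(\<integral>\<^sup>+x. ennreal (exp (- (norm x)\<^sup>2)) \<partial>frame_lborel 0 B)
     = (\<integral>\<^sup>+t. ennreal (exp (- t\<^sup>2)) \<partial>lborel) ^ card B"
proof -
  interpret product_sigma_finite "\<lambda>_::'a. lborel :: real measure" by standard
  have "(\<integral>\<^sup>+x. ennreal (exp (- (norm x)\<^sup>2)) \<partial>frame_lborel 0 B)
      = (\<integral>\<^sup>+c. (\<Prod>b\<in>B. ennreal (exp (- (c b)\<^sup>2))) \<partial>(\<Pi>\<^sub>M b\<in>B. (lborel :: real measure)))"
    by (subst nn_integral_frame_lborel)
       (auto simp: frame_norm sum_negf[symmetric] exp_sum frame_finite prod_ennreal)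
  also have "\<dots> = (\<Prod>b\<in>B. \<integral>\<^sup>+t. ennreal (exp (- t\<^sup>2)) \<partial>lborel)"
    by (rule product_nn_integral_prod[OF frame_finite]) auto
  finally show ?thesis by simp
qed

end

lemma gaussian_nn_integral_finite: "(\<integral>\<^sup>+t. ennreal (exp (- t\<^sup>2)) \<partial>(lborel :: real measure)) < \<infinity>"
proof -
  have half: "(\<integral>\<^sup>+t. ennreal (exp 1 * exp (- t)) * indicator {0..} t \<partial>lborel) = ennreal (exp 1)"
  proof -
    have "(\<integral>\<^sup>+t. ennreal (exp 1 * exp (- t)) * indicator {0..} t \<partial>lborel) = ennreal (0 - (- exp 1 * exp (- 0)))"
    proof (rule nn_integral_FTC_atLeast)
      show "((\<lambda>x::real. - exp 1 * exp (- x)) \<longlongrightarrow> 0) at_top"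
        using tendsto_mult_right_zero[OF filterlim_compose[OF exp_at_bot filterlim_uminus_at_bot_at_top],
            where c="- exp (1::real)"]
        by simp
    qed (auto intro!: derivative_eq_intros)
    then show ?thesis by simp
  qed
  have bound: "exp (- t\<^sup>2) \<le> exp 1 * exp (- \<bar>t\<bar>)" for t :: real
  proof -
    have "0 \<le> (2 * \<bar>t\<bar> - 1)\<^sup>2" by simp
    moreover have "(2 * \<bar>t\<bar> - 1)\<^sup>2 = 4 * t\<^sup>2 - 4 * \<bar>t\<bar> + 1"
      by (simp add: power2_eq_square algebra_simps)
    ultimately have "- t\<^sup>2 \<le> 1 + - \<bar>t\<bar>" by linarith
    then show ?thesis by (metis exp_add exp_le_cancel_iff)
  qed
  have "(\<integral>\<^sup>+t. ennreal (exp (- t\<^sup>2)) \<partial>(lborel :: real measure))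
      \<le> (\<integral>\<^sup>+t. ennreal (exp 1 * exp (- t)) * indicator {0..} t
            + ennreal (exp 1 * exp (- (- t))) * indicator {0..} (- t) \<partial>lborel)"
  proof (rule nn_integral_mono)
    fix t :: real
    show "ennreal (exp (- t\<^sup>2)) \<le> ennreal (exp 1 * exp (- t)) * indicator {0..} t
            + ennreal (exp 1 * exp (- (- t))) * indicator {0..} (- t)"
      using bound[of t] by (cases "t \<ge> 0"; cases "t = 0") (auto simp: indicator_def intro!: ennreal_leI add_increasing2)
  qed
  also have "\<dots> = ennreal (exp 1) + (\<integral>\<^sup>+t. ennreal (exp 1 * exp (- (- t))) * indicator {0..} (- t) \<partial>lborel)"
    by (subst nn_integral_add) (auto simp: half)
  also have "(\<integral>\<^sup>+t. ennreal (exp 1 * exp (- (- t))) * indicator {0..} (- t) \<partial>lborel)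
      = (\<integral>\<^sup>+t. ennreal (exp 1 * exp (- t)) * indicator {0..} t \<partial>distr lborel borel uminus)"
    by (subst nn_integral_distr) auto
  also have "\<dots> = ennreal (exp 1)" by (simp add: lborel_distr_uminus half)
  finally show ?thesis by (simp add: ennreal_plus[symmetric] le_less_trans del: ennreal_plus)
qed

lemma gaussian_nn_integral_pos: "(\<integral>\<^sup>+t. ennreal (exp (- t\<^sup>2)) \<partial>(lborel :: real measure)) \<noteq> 0"
  by (subst nn_integral_0_iff) auto

lemma frame_lborel_0_unique:
  fixes B C :: "'a::euclidean_space set"
  assumes B: "pairwise orthogonal B" "\<And>b. b \<in> B \<Longrightarrow> norm b = 1"
    and C: "pairwise orthogonal C" "\<And>b. b \<in> C \<Longrightarrow> norm b = 1"
    and span: "span B = span C"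
  shows "frame_lborel 0 B = frame_lborel 0 C"
proof (rule measure_eqI)
  show "sets (frame_lborel 0 B) = sets (frame_lborel 0 C)" by (simp add: B C)
  let ?\<nu> = "frame_lborel 0 B" and ?\<mu> = "frame_lborel 0 C"
  note [measurable_cong] = sets_frame_lborel[OF B, of 0] sets_frame_lborel[OF C, of 0]
  interpret N: sigma_finite_measure ?\<nu> by (rule sigma_finite_frame_lborel[OF B])
  interpret M: sigma_finite_measure ?\<mu> by (rule sigma_finite_frame_lborel[OF C])
  interpret pair_sigma_finite ?\<nu> ?\<mu> ..
  have AE_N: "AE x in ?\<nu>. x \<in> span B" by (rule AE_frame_lborel) (fact B)+
  have AE_M: "AE x in ?\<mu>. x \<in> span C" by (rule AE_frame_lborel) (fact C)+
  fix X assume "X \<in> sets ?\<nu>"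
  then have [measurable]: "X \<in> sets borel" by (simp add: B)
  define f where "f = (indicator X :: 'a \<Rightarrow> ennreal)"
  define g where "g x = ennreal (exp (- (norm x)\<^sup>2))" for x :: 'a
  have [measurable]: "f \<in> borel_measurable borel" "g \<in> borel_measurable borel"
    by (auto simp: f_def g_def[abs_def])
  have g_minus: "g (- x) = g x" for x by (simp add: g_def)
  have "(\<integral>\<^sup>+x. f x \<partial>?\<nu>) * (\<integral>\<^sup>+y. g y \<partial>?\<mu>) = (\<integral>\<^sup>+x. f x * (\<integral>\<^sup>+y. g y \<partial>?\<mu>) \<partial>?\<nu>)"
    by (simp add: nn_integral_multc)
  also have "\<dots> = (\<integral>\<^sup>+x. (\<integral>\<^sup>+y. f x * g (x - y) \<partial>?\<mu>) \<partial>?\<nu>)"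
  proof (rule nn_integral_cong_AE)
    show "AE x in ?\<nu>. f x * (\<integral>\<^sup>+y. g y \<partial>?\<mu>) = (\<integral>\<^sup>+y. f x * g (x - y) \<partial>?\<mu>)"
      using AE_N by eventually_elim
        (simp add: nn_integral_cmult frame_lborel_reflect[OF C] span)
  qed
  also have "\<dots> = (\<integral>\<^sup>+y. (\<integral>\<^sup>+x. f x * g (x - y) \<partial>?\<nu>) \<partial>?\<mu>)"
    by (rule Fubini'[symmetric]) measurable
  also have "\<dots> = (\<integral>\<^sup>+y. (\<integral>\<^sup>+x. f (y + x) * g x \<partial>?\<nu>) \<partial>?\<mu>)"
  proof (rule nn_integral_cong_AE)
    show "AE y in ?\<mu>. (\<integral>\<^sup>+x. f x * g (x - y) \<partial>?\<nu>) = (\<integral>\<^sup>+x. f (y + x) * g x \<partial>?\<nu>)"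
      using AE_M
    proof eventually_elim
      case (elim y)
      show ?case
        using frame_lborel_shift[OF B, of "\<lambda>x. f x * g (x - y)" y] elim by (simp add: span)
    qed
  qed
  also have "\<dots> = (\<integral>\<^sup>+x. (\<integral>\<^sup>+y. f (y + x) * g x \<partial>?\<mu>) \<partial>?\<nu>)"
    by (rule Fubini') measurable
  also have "\<dots> = (\<integral>\<^sup>+x. (\<integral>\<^sup>+y. f y \<partial>?\<mu>) * g x \<partial>?\<nu>)"
  proof (rule nn_integral_cong_AE)
    show "AE x in ?\<nu>. (\<integral>\<^sup>+y. f (y + x) * g x \<partial>?\<mu>) = (\<integral>\<^sup>+y. f y \<partial>?\<mu>) * g x"
      using AE_N
    proof eventually_elim
      case (elim x)
      then show ?case
        using frame_lborel_shift[OF C, of f x]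
        by (simp add: nn_integral_multc span add.commute)
    qed
  qed
  also have "\<dots> = (\<integral>\<^sup>+y. f y \<partial>?\<mu>) * (\<integral>\<^sup>+x. g x \<partial>?\<nu>)"
    by (simp add: nn_integral_cmult)
  finally have eq: "emeasure ?\<nu> X * (\<integral>\<^sup>+y. g y \<partial>?\<mu>) = emeasure ?\<mu> X * (\<integral>\<^sup>+y. g y \<partial>?\<nu>)"
    by (simp add: f_def)
  have "card B = card C"
    using frame_independent[OF B] frame_independent[OF C] span
    by (metis dim_eq_card_independent dim_span)
  then have "(\<integral>\<^sup>+y. g y \<partial>?\<mu>) = (\<integral>\<^sup>+y. g y \<partial>?\<nu>)"
    by (simp add: g_def nn_integral_frame_gaussian[OF B] nn_integral_frame_gaussian[OF C])
  moreover have "(\<integral>\<^sup>+y. g y \<partial>?\<nu>) \<noteq> 0" "(\<integral>\<^sup>+y. g y \<partial>?\<nu>) < \<infinity>"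
    using gaussian_nn_integral_finite gaussian_nn_integral_pos
    by (auto simp: g_def nn_integral_frame_gaussian[OF B] power_less_top_ennreal)
  ultimately show "emeasure ?\<nu> X = emeasure ?\<mu> X"
    using eq by (auto simp: mult.commute[of "emeasure _ X"] ennreal_mult_cancel_left)
qed

lemma frame_lborel_unique:
  assumes "orthonormal_frame A a B" "orthonormal_frame A a' C"
  shows "frame_lborel a B = frame_lborel a' C"
proof -
  have B: "pairwise orthogonal B" "\<And>b. b \<in> B \<Longrightarrow> norm b = 1"
    and C: "pairwise orthogonal C" "\<And>b. b \<in> C \<Longrightarrow> norm b = 1"
    and A: "(\<lambda>v. a + v) ` span B = (\<lambda>v. a' + v) ` span C"
    using assms by (auto simp: orthonormal_frame_def)
  have "a' \<in> (\<lambda>v. a + v) ` span B" unfolding A using span_zero by force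
  then obtain u where u: "u \<in> span B" "a' = a + u" by blast
  have "(\<lambda>v. a + v) ` span B = (\<lambda>v. a + v) ` ((\<lambda>v. u + v) ` span C)"
    unfolding A by (simp add: u image_image add.assoc)
  then have "span B = (\<lambda>v. u + v) ` span C"
    by (simp add: inj_image_eq_iff)
  moreover have "(\<lambda>v. - u + v) ` span B = span B"
  proof
    show "(\<lambda>v. - u + v) ` span B \<subseteq> span B"
      using u by (auto simp: span_diff)
    show "span B \<subseteq> (\<lambda>v. - u + v) ` span B"
    proof
      fix x assume "x \<in> span B"
      then have "u + x \<in> span B" using u by (simp add: span_add)
      then show "x \<in> (\<lambda>v. - u + v) ` span B" by (intro image_eqI[of _ _ "u + x"]) auto
    qed
  qed
  moreover have "(\<lambda>v. - u + v) ` ((\<lambda>v. u + v) ` span C) = span C"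
    by (simp add: image_image)
  ultimately have span: "span B = span C" by simp
  have "frame_lborel a B = frame_lborel a' B"
  proof (rule measure_eqI)
    fix X assume "X \<in> sets (frame_lborel a B)"
    then have [measurable]: "X \<in> sets borel" by (simp add: B)
    have m: "(\<integral>\<^sup>+x. indicator X x \<partial>frame_lborel c B) = (\<integral>\<^sup>+x. indicator X (c + x) \<partial>frame_lborel 0 B)" for c
      by (simp add: nn_integral_frame_lborel[OF B])
    have "emeasure (frame_lborel a' B) X = (\<integral>\<^sup>+x. indicator X x \<partial>frame_lborel a' B)"
      by (simp add: B)
    also have "\<dots> = (\<integral>\<^sup>+x. indicator X (a + (u + x)) \<partial>frame_lborel 0 B)"
      by (simp only: m u add.assoc)
    also have "\<dots> = (\<integral>\<^sup>+x. indicator X (a + x) \<partial>frame_lborel 0 B)"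
      by (rule frame_lborel_shift[OF B, of "\<lambda>x. indicator X (a + x)"]) (use u in auto)
    also have "\<dots> = emeasure (frame_lborel a B) X" by (simp add: m[symmetric] B)
    finally show "emeasure (frame_lborel a B) X = emeasure (frame_lborel a' B) X" ..
  qed (simp add: B)
  also have "\<dots> = distr (frame_lborel 0 B) borel (\<lambda>x. a' + x)"
    unfolding frame_lborel_def by (subst distr_distr) (auto simp: o_def)
  also have "\<dots> = distr (frame_lborel 0 C) borel (\<lambda>x. a' + x)"
    by (simp add: frame_lborel_0_unique[OF B C span])
  also have "\<dots> = frame_lborel a' C"
    unfolding frame_lborel_def by (subst distr_distr) (auto simp: o_def)
  finally show ?thesis .
qed

theorem affine_lborel_eq_frame_lborel:
  assumes "orthonormal_frame A a B"
  shows "affine_lborel A = frame_lborel a B"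
proof -
  let ?p = "SOME p. orthonormal_frame A (fst p) (snd p)"
  have "orthonormal_frame A (fst ?p) (snd ?p)"
    by (rule someI[of "\<lambda>p. orthonormal_frame A (fst p) (snd p)" "(a, B)"]) (simp add: assms)
  then show ?thesis
    unfolding affine_lborel_def Let_def by (rule frame_lborel_unique[OF _ assms])
qed

lemma affine_lborel_UNIV: "affine_lborel (UNIV :: 'a::euclidean_space set) = lborel"
proof -
  have "orthonormal_frame (UNIV :: 'a set) 0 Basis"
    by (auto simp: orthonormal_frame_def pairwise_def orthogonal_def inner_Basis)
  then show ?thesis
    by (simp add: affine_lborel_eq_frame_lborel frame_lborel_def lborel_eq[where 'a='a])
qed

lemma aff_dim_section:
  fixes H :: "(real ^ 'n::finite) set"
  assumes H: "subspace H" and c: "simplex_centroid \<in> H"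
  shows "affine (H \<inter> sum_one_hyperplane)" and "aff_dim (H \<inter> sum_one_hyperplane) = int (dim H) - 1"
proof -
  have hyp: "sum_one_hyperplane = {x :: real ^ 'n. (\<chi> j. 1) \<bullet> x = 1}"
    by (simp add: sum_one_hyperplane_def inner_vec_def)
  have aff: "affine H" using H by (rule subspace_imp_affine)
  have mem: "simplex_centroid \<in> H \<inter> sum_one_hyperplane"
    using c by (simp add: sum_one_hyperplane_def simplex_centroid_def)
  show "affine (H \<inter> sum_one_hyperplane)"
    unfolding hyp by (intro affine_Int aff affine_hyperplane)
  have "0 \<in> H" using H by (rule subspace_0)
  then have "\<not> H \<subseteq> sum_one_hyperplane" by (auto simp: sum_one_hyperplane_def)
  then have "aff_dim (H \<inter> sum_one_hyperplane) = aff_dim H - 1"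
    using aff_dim_affine_Int_hyperplane[OF aff, of "\<chi> j. 1" 1] mem by (auto simp: hyp)
  then show "aff_dim (H \<inter> sum_one_hyperplane) = int (dim H) - 1"
    by (simp add: aff_dim_subspace[OF H])
qed

end

theory Submission
  imports Defs "HOL-Probability.Probability"
begin

text \<open>
  Write \<open>N = n + 1\<close>. The volume of the section is turned into an integral over a cone: slicing the
  nonnegative cone of \<open>H\<close> by coordinate sum gives
  \<open>section_vol H = sqrt N / fact (k - 1) * I\<close>, where \<open>I\<close> is the integral of
  \<open>exp (- (x\<^sub>1 + \<dots> + x\<^sub>N))\<close> over the vectors of \<open>H\<close> with nonnegative coordinates
  (\<open>section_vol_eq_exp_integral\<close>). On \<open>H\<close> the coordinate \<open>x\<^sub>j\<close> is the inner product with the projection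
  \<open>p\<^sub>j\<close> of the vertex \<open>e\<^sub>j\<close>, and the operators \<open>p\<^sub>j \<otimes> p\<^sub>j\<close> add up to the identity of \<open>H\<close>. The integrand is
  a product of one-dimensional exponential densities, one for each \<open>p\<^sub>j\<close>, so the geometric
  Brascamp-Lieb inequality bounds \<open>I\<close> by the product of \<open>c\<^sub>j powr (c\<^sub>j / 2)\<close> with
  \<open>c\<^sub>j = (norm p\<^sub>j)\<^sup>2\<close> (\<open>brascamp_lieb_exponential\<close>, \<open>exp_integral_le\<close>). It is proved
  by transport: the map built from the one-dimensional monotone transport of the exponential law to the
  normal law sends the cone into a space with the Gaussian measure, and its Jacobian is controlled by a
  determinant inequality, which follows from the spectral theorem and the concavity of the logarithm.

  What remains is to maximise \<open>\<Sum>j. c\<^sub>j * ln c\<^sub>j\<close>. The numbers \<open>c\<^sub>j\<close> have sum \<open>k\<close> and are at most \<open>1\<close>. Since \<open>H\<close>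
  contains the centroid, they are at least \<open>1 / N\<close>, and since \<open>c\<^sub>j = 1 - (dist(H, e\<^sub>j))\<^sup>2\<close>, the distance condition
  says exactly that they are at least \<open>1 / (N + 1 - k)\<close>. As \<open>x * ln x\<close> is convex, the maximum is attained
  when all \<open>c\<^sub>j\<close> except at most one are at the ends of the interval. In the first case these are
  \<open>k - 1\<close> ones, one value \<open>k / N\<close> and otherwise \<open>1 / N\<close>; in the second case \<open>k - 1\<close> ones and otherwise
  \<open>1 / (N + 1 - k)\<close>. The second configuration belongs to an actual subspace, spanned by the centroid and
  \<open>k - 1\<close> vertices, for which \<open>I\<close> factorises and the bound is an equality (\<open>block_frame\<close>).
\<close>

section \<open>Extremal values of convex sums\<close>

lemma convex_on_x_ln_x: "convex_on {0<..} (\<lambda>x::real. x * ln x)"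
proof (rule convex_on_realI)
  show "((\<lambda>x. x * ln x) has_real_derivative ln x + 1) (at x)" if "x \<in> {0<..}" for x :: real
    using that by (auto intro!: derivative_eq_intros)
qed auto

text \<open>
  Moving two points of an interval to its ends, with the sum kept, increases a convex sum: both
  points lie below the secant, and the secant is affine.
\<close>
lemma convex_on_two_point_majorization:
  fixes f :: "real \<Rightarrow> real"
  assumes f: "convex_on {u..v} f" and x: "x \<in> {u..v}" and sum: "x + y = u + v"
  shows "f x + f y \<le> f u + f v"
proof (cases "u = v")
  case True
  then have "x = u" "y = u" using x sum by auto
  then show ?thesis using True by simp
next
  case False
  define s where "s = (f v - f u) / (v - u)"
  have y: "y \<in> {u..v}" using x sum by auto
  have "f x + f y \<le> (s * (x - u) + f u) + (s * (y - u) + f u)"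
    using convex_onD_Icc'[OF f x] convex_onD_Icc'[OF f y] by (simp add: s_def)
  also have "\<dots> = s * (x + y - 2 * u) + 2 * f u" by (simp add: algebra_simps)
  also have "\<dots> = s * (v - u) + 2 * f u" by (simp add: sum)
  also have "s * (v - u) = f v - f u" using False by (simp add: s_def)
  finally show ?thesis by simp
qed

text \<open>
  A convex function of points in \<open>[a, b]\<close> with prescribed sum is largest when all points but one
  sit at the ends of the interval. New points are added one at a time: the old exceptional value
  \<open>r\<close> and the new point are pushed apart until one of them reaches an end.
\<close>
lemma convex_sum_le_extremal:
  fixes f :: "real \<Rightarrow> real"
  assumes "finite J" "J \<noteq> {}" "convex_on {a..b} f" "\<And>j. j \<in> J \<Longrightarrow> c j \<in> {a..b}"
  shows "\<exists>m r. m < card J \<and> r \<in> {a..b} \<and>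
      sum c J = real m * b + r + (real (card J) - 1 - real m) * a \<and>
      (\<Sum>j\<in>J. f (c j)) \<le> real m * f b + f r + (real (card J) - 1 - real m) * f a"
  using assms(1,2,4)
proof (induction J rule: finite_ne_induct)
  case (singleton j)
  then show ?case by (intro exI[of _ 0] exI[of _ "c j"]) auto
next
  case (insert j J)
  obtain m r where m: "m < card J" and r: "r \<in> {a..b}"
    and sum: "sum c J = real m * b + r + (real (card J) - 1 - real m) * a"
    and le: "(\<Sum>j\<in>J. f (c j)) \<le> real m * f b + f r + (real (card J) - 1 - real m) * f a"
    using insert.IH insert.prems by (metis insert_iff)
  have cj: "c j \<in> {a..b}" using insert.prems by simp
  have card: "card (insert j J) = Suc (card J)" using insert.hyps by simp
  have conv: "convex_on {u..v} f" if "a \<le> u" "v \<le> b" for u v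
    using assms(3) by (rule convex_on_subset) (use that in auto)
  show ?case
  proof (cases "r + c j \<le> a + b")
    case True
    (* There is room below b: the pair moves to the lower end and the rest of its sum. *)
    then have "f r + f (c j) \<le> f a + f (r + c j - a)"
      using r cj by (intro convex_on_two_point_majorization conv) auto
    then show ?thesis
      using m r cj sum le True insert.hyps
      by (intro exI[of _ m] exI[of _ "r + c j - a"]) (auto simp: card algebra_simps)
  next
    case False
    then have "f r + f (c j) \<le> f (r + c j - b) + f b"
      using r cj by (intro convex_on_two_point_majorization conv) auto
    then show ?thesis
      using m r cj sum le False insert.hyps
      by (intro exI[of _ "Suc m"] exI[of _ "r + c j - b"]) (auto simp: card algebra_simps)
  qed
qed

text \<open>
  The value on the right is attained by \<open>k - 1\<close> entries \<open>1\<close>, one entry \<open>k / N\<close> and \<open>N - k\<close> entries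
  \<open>1 / N\<close>, which is the extremal configuration for entries in \<open>[1 / N, 1]\<close> of total \<open>k\<close>.
\<close>
lemma sum_x_ln_x_le_of_sum_eq:
  fixes c :: "'j \<Rightarrow> real"
  assumes J: "finite J" "card J = N" "0 < N"
    and k: "1 \<le> k" "k \<le> N"
    and c: "\<And>j. j \<in> J \<Longrightarrow> c j \<in> {1 / real N..1}" and sum: "sum c J = real k"
  shows "(\<Sum>j\<in>J. c j * ln (c j)) \<le> real k / real N * ln (real k) - ln (real N)"
proof -
  define f where "f x = x * ln x" for x :: real
  have "convex_on {1 / real N..1} f"
    unfolding f_def using convex_on_x_ln_x by (rule convex_on_subset) (use J in \<open>auto intro: less_le_trans[of 0 "1 / real N"]\<close>)
  then obtain m r where m: "m < N" and r: "1 / real N \<le> r" "r \<le> 1"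
    and s: "real k = real m + r + (real N - 1 - real m) / real N"
    and le: "(\<Sum>j\<in>J. f (c j)) \<le> real m * f 1 + f r + (real N - 1 - real m) * f (1 / real N)"
    using convex_sum_le_extremal[of J "1 / real N" 1 f c] J c sum card_gt_0_iff[of J] by auto
  have s': "real N * real k = real N * real m + real N * r + (real N - 1 - real m)"
    using s J by (simp add: field_simps)
  have r': "1 \<le> real N * r" "real N * r \<le> real N" using r J by (simp_all add: field_simps)
  (* The representation of the sum is unique except at the ends of the interval, where
    \<open>r\<close> may be traded for one more or one less entry \<open>1\<close>; both cases are excluded by \<open>1 \<le> k \<le> N\<close>. *)
  have "real N * real k \<ge> real N * real m - real m + real N"
    using s' r' by linarith
  then have low: "real N * (real m + 1 - real k) \<le> real m" by (simp add: algebra_simps)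
  have "real N * real k \<le> (real N - 1) * (real m + 1) + real N"
    using s' r' by (simp add: algebra_simps)
  then have up: "(real N - 1) * (real m + 1) \<ge> real N * (real k - 1)" by (simp add: algebra_simps)
  have "m + 1 \<le> k"
  proof (rule ccontr)
    assume "\<not> m + 1 \<le> k"
    then have "real N * 1 \<le> real N * (real m + 1 - real k)" by (intro mult_left_mono) auto
    then have "real N * 1 \<le> real m" using low by (rule order_trans)
    then show False using m by simp
  qed
  moreover have "k \<le> m + 1"
  proof (rule ccontr)
    assume "\<not> k \<le> m + 1"
    then have "real N * (real m + 1) \<le> real N * (real k - 1)" by (intro mult_left_mono) auto
    then show False using up by (simp add: algebra_simps)
  qed
  ultimately have mk: "k = m + 1" by simp
  then have "real N * r = real k" using s' by (simp add: algebra_simps)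
  then have rk: "r = real k / real N" using J by (simp add: field_simps)
  have "(\<Sum>j\<in>J. c j * ln (c j)) \<le> f r + (real N - real k) * f (1 / real N)"
    using le by (simp add: f_def mk algebra_simps)
  also have "\<dots> = real k / real N * ln (real k) - ln (real N)"
    using J k by (simp add: f_def rk ln_div field_simps)
  finally show ?thesis .
qed

text \<open>
  With the lower bound \<open>1 / M\<close>, where \<open>M = N + 1 - k\<close>, the extremal configuration has entries \<open>1\<close>
  (\<open>k - 1\<close> times) and \<open>1 / M\<close> (\<open>M\<close> times) only, so the secant through the ends of the interval
  already gives the sharp bound.
\<close>
lemma sum_x_ln_x_le_of_lower_bound:
  fixes c :: "'j \<Rightarrow> real"
  assumes J: "finite J" "card J = N"
    and k: "1 \<le> k" "k \<le> N" and M: "M = N + 1 - k"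
    and c: "\<And>j. j \<in> J \<Longrightarrow> c j \<in> {1 / real M..1}" and sum: "sum c J = real k"
  shows "(\<Sum>j\<in>J. c j * ln (c j)) \<le> - ln (real M)"
proof (cases "M = 1")
  case True
  then have "c j = 1" if "j \<in> J" for j using c[OF that] by simp
  then show ?thesis using True by simp
next
  case False
  then have M1: "1 < real M" using k M by linarith
  define f where "f x = x * ln x" for x :: real
  have "convex_on {1 / real M..1} f"
    unfolding f_def using convex_on_x_ln_x
    by (rule convex_on_subset) (use M1 in \<open>auto intro: less_le_trans[of 0 "1 / real M"]\<close>)
  note secant = convex_onD_Icc'[OF this]
  define s where "s = (f 1 - f (1 / real M)) / (1 - 1 / real M)"
  have s: "s = ln (real M) / (real M - 1)"
    using M1 by (simp add: s_def f_def ln_div field_simps)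
  have N: "real N = real M + real k - 1" using M k by simp
  have "(\<Sum>j\<in>J. c j * ln (c j)) \<le> (\<Sum>j\<in>J. s * (c j - 1 / real M) + f (1 / real M))"
    using secant[OF c] by (intro sum_mono) (simp add: f_def s_def)
  also have "\<dots> = s * (real k - real N / real M) + real N * f (1 / real M)"
    using J sum by (simp add: sum.distrib sum_subtractf flip: sum_distrib_left)
  also have "\<dots> = - ln (real M)"
    using M1 unfolding s N f_def by (simp add: ln_div divide_simps) (simp add: algebra_simps)
  finally show ?thesis .
qed

section \<open>Monotone transport from the exponential to the normal law\<close>

lemma std_normal_cdf:
  defines "G \<equiv> cdf (density lborel std_normal_density)"
  shows "(G has_real_derivative std_normal_density s) (at s)"
    and "(G \<longlongrightarrow> 0) at_bot" and "(G \<longlongrightarrow> 1) at_top"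
proof -
  let ?M = "density lborel std_normal_density"
  interpret M: prob_space ?M by (rule prob_space_normal_density) simp
  interpret M: real_distribution ?M by standard auto
  show "(G \<longlongrightarrow> 0) at_bot" "(G \<longlongrightarrow> 1) at_top"
    unfolding G_def by (rule M.cdf_lim_at_bot M.cdf_lim_at_top_prob)+
  have diff: "G x = G a + integral {a..x} std_normal_density" if "a < x" for a x
  proof -
    have "G x - G a = measure ?M {a<..x}" unfolding G_def by (rule M.cdf_diff_eq[OF that])
    also have "\<dots> = (\<integral>t. indicator {a<..x} t \<partial>?M)" by simp
    also have "\<dots> = (LINT t:{a<..x}|lborel. std_normal_density t)"
      unfolding set_lebesgue_integral_def
      by (subst integral_real_density) (auto simp: mult.commute intro!: Bochner_Integration.integral_cong)
    also have "\<dots> = integral {a<..x} std_normal_density"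
      using integrable_mult_indicator[of "{a<..x}" lborel std_normal_density]
      by (intro set_borel_integral_eq_integral) (simp add: set_integrable_def)
    also have "\<dots> = integral {a..x} std_normal_density"
      by (rule integral_spike_set) (auto intro: negligible_subset[of "{a}"])
    finally show ?thesis by simp
  qed
  have "((\<lambda>x. integral {s - 1..x} std_normal_density) has_real_derivative std_normal_density s)
      (at s within {s - 1..s + 1})"
    by (rule integral_has_real_derivative) (auto simp: normal_density_def intro!: continuous_intros)
  then have "((\<lambda>x. integral {s - 1..x} std_normal_density) has_real_derivative std_normal_density s) (at s)"
    by (simp add: at_within_Icc_at)
  then have "((\<lambda>x. G (s - 1) + integral {s - 1..x} std_normal_density) has_real_derivative
      std_normal_density s) (at s)"
    by (auto intro!: derivative_eq_intros)
  then show "(G has_real_derivative std_normal_density s) (at s)"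
    by (rule has_field_derivative_transform_within[where d = 1])
       (auto simp: dist_real_def intro!: diff[symmetric])
qed

text \<open>
  The monotone map carrying the standard exponential law to the standard normal law: its inverse
  is \<open>s \<mapsto> - ln (1 - G s)\<close> with \<open>G\<close> the normal distribution function, since both laws
  must give the same mass to corresponding tails.
\<close>
lemma exponential_to_normal_transport:
  obtains \<tau> \<tau>' :: "real \<Rightarrow> real"
  where "\<And>r. 0 < r \<Longrightarrow> (\<tau> has_real_derivative \<tau>' r) (at r)"
    and "\<And>r. 0 < r \<Longrightarrow> 0 < \<tau>' r"
    and "\<And>r. 0 < r \<Longrightarrow> exp (- r) = std_normal_density (\<tau> r) * \<tau>' r"
proof -
  define G where "G = cdf (density lborel std_normal_density)"
  have DG: "(G has_real_derivative std_normal_density s) (at s)" for s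
    unfolding G_def by (rule std_normal_cdf)
  have \<phi>: "0 < std_normal_density s" for s by (simp add: normal_density_pos)
  have mono: "G s < G t" if "s < t" for s t
    using that DG \<phi> by (meson DERIV_pos_imp_increasing)
  have lim: "(G \<longlongrightarrow> 0) at_bot" "(G \<longlongrightarrow> 1) at_top"
    unfolding G_def by (rule std_normal_cdf)+
  have surj: "\<exists>s. G s = u" if u: "0 < u" "u < 1" for u
  proof -
    obtain a where a: "G a < u"
      using order_tendstoD(2)[OF lim(1) u(1)] by (auto simp: eventually_at_bot_linorder)
    obtain b where b: "u < G b"
      using order_tendstoD(1)[OF lim(2) u(2)] by (auto simp: eventually_at_top_linorder)
    have "a \<le> b" using a b mono[of b a] by (cases "a \<le> b") auto
    then show ?thesis
      using IVT[of G a u b] a b DG DERIV_isCont by (meson less_imp_le)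
  qed
  have G_less: "G s < 1" for s
  proof -
    have "\<forall>\<^sub>F x in at_top. G (s + 1) \<le> G x"
      unfolding eventually_at_top_linorder using mono by (metis less_eq_real_def)
    then have "G (s + 1) \<le> 1" using lim(2) by (intro tendsto_lowerbound[of G 1 at_top]) auto
    then show ?thesis using mono[of s "s + 1"] by simp
  qed
  have G_pos: "0 < G s" for s
  proof -
    have "\<forall>\<^sub>F x in at_bot. G x \<le> G (s - 1)"
      unfolding eventually_at_bot_linorder using mono by (metis less_eq_real_def)
    then have "0 \<le> G (s - 1)" using lim(1) by (intro tendsto_upperbound[of G 0 at_bot]) auto
    then show ?thesis using mono[of "s - 1" s] by simp
  qed
  define \<rho> where "\<rho> s = - ln (1 - G s)" for s
  have D\<rho>: "(\<rho> has_real_derivative std_normal_density s / (1 - G s)) (at s)" for s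
    unfolding \<rho>_def using G_less[of s] by (auto intro!: derivative_eq_intros DG simp: field_simps)
  have \<rho>_pos: "0 < \<rho> s" for s using G_less[of s] G_pos[of s] by (simp add: \<rho>_def)
  have "\<exists>s. \<rho> s = r" if "0 < r" for r
  proof -
    obtain s where "G s = 1 - exp (- r)" using surj[of "1 - exp (- r)"] \<open>0 < r\<close> by auto
    then show ?thesis by (intro exI[of _ s]) (simp add: \<rho>_def)
  qed
  then obtain \<tau> where \<tau>: "\<And>r. 0 < r \<Longrightarrow> \<rho> (\<tau> r) = r" by metis
  have inj: "\<rho> s = \<rho> t \<Longrightarrow> s = t" for s t
    using G_less[of s] G_less[of t] mono[of s t] mono[of t s]
    by (cases s t rule: linorder_cases) (auto simp: \<rho>_def)
  have \<tau>\<rho>: "\<tau> (\<rho> s) = s" for s by (rule inj) (rule \<tau>[OF \<rho>_pos])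
  have cont: "isCont \<tau> r" if "0 < r" for r
  proof -
    have "isCont \<tau> (\<rho> (\<tau> r))"
      by (rule isCont_inverse_function[where f = \<rho> and d = 1]) (use \<tau>\<rho> DERIV_isCont[OF D\<rho>] in auto)
    then show ?thesis by (simp add: \<tau> that)
  qed
  have G\<tau>: "1 - G (\<tau> r) = exp (- r)" if "0 < r" for r
    using \<tau>[OF that] G_less[of "\<tau> r"] unfolding \<rho>_def
    by (metis add.inverse_inverse diff_gt_0_iff_gt exp_ln)
  show thesis
  proof
    fix r :: real assume r: "0 < r"
    let ?D = "exp (- r) / std_normal_density (\<tau> r)"
    have "(\<tau> has_real_derivative inverse (std_normal_density (\<tau> r) / (1 - G (\<tau> r)))) (at r)"
      using r \<phi>[of "\<tau> r"] G_less[of "\<tau> r"]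
      by (intro DERIV_inverse_function[where f = \<rho> and a = 0 and b = "r + 1"] D\<rho> cont) (auto simp: \<tau>)
    then show "(\<tau> has_real_derivative ?D) (at r)"
      using r by (simp add: G\<tau>)
    show "0 < ?D" using \<phi> by simp
    show "exp (- r) = std_normal_density (\<tau> r) * ?D" using \<phi>[of "\<tau> r"] by simp
  qed
qed

section \<open>The spectral theorem and a determinant inequality\<close>

text \<open>
  A maximiser \<open>v\<close> of the Rayleigh quotient on the unit sphere of \<open>V\<close> is an eigenvector: otherwise
  the residual \<open>w = f v - l *\<^sub>R v\<close> would be a direction of first-order increase.
\<close>
lemma self_adjoint_eigenvector_exists:
  fixes f :: "'a::euclidean_space \<Rightarrow> 'a"
  assumes f: "linear f" and adj: "\<And>x y. f x \<bullet> y = x \<bullet> f y"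
    and V: "subspace V" "\<And>x. x \<in> V \<Longrightarrow> f x \<in> V" "V \<noteq> {0}"
  shows "\<exists>v\<in>V. norm v = 1 \<and> f v = (f v \<bullet> v) *\<^sub>R v"
proof -
  let ?S = "V \<inter> sphere 0 1"
  interpret f: linear f by (rule f)
  have compact: "compact ?S" using V(1) by (intro closed_Int_compact closed_subspace) auto
  obtain u where "u \<in> V" "u \<noteq> 0" using V(1,3) subspace_0 by blast
  then have "(1 / norm u) *\<^sub>R u \<in> ?S" using V(1) by (simp add: subspace_scale)
  then have "?S \<noteq> {}" by blast
  moreover have "continuous_on ?S (\<lambda>x. f x \<bullet> x)"
    using f by (intro continuous_intros linear_continuous_on linear_linear[THEN iffD1]) (auto simp: linear_conv_bounded_linear)
  ultimately obtain v where v: "v \<in> ?S" and max: "\<And>x. x \<in> ?S \<Longrightarrow> f x \<bullet> x \<le> f v \<bullet> v"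
    using continuous_attains_sup[OF compact] by blast
  define l where "l = f v \<bullet> v"
  define w where "w = f v - l *\<^sub>R v"
  have vv: "v \<bullet> v = 1" using v by (simp add: dot_square_norm)
  have wV: "w \<in> V" using v V by (simp add: w_def subspace_diff subspace_scale)
  have wv: "w \<bullet> v = 0" by (simp add: w_def inner_diff_left l_def vv)
  have wfv: "w \<bullet> f v = w \<bullet> w"
  proof -
    have "w \<bullet> w = w \<bullet> f v - l * (w \<bullet> v)" by (subst (2) w_def) (simp add: inner_diff_right)
    then show ?thesis by (simp add: wv)
  qed
  have rayleigh: "f x \<bullet> x \<le> l * (x \<bullet> x)" if "x \<in> V" for x
  proof (cases "x = 0")
    case False
    have "(1 / norm x) *\<^sub>R x \<in> ?S" using False V(1) that by (simp add: subspace_scale)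
    from max[OF this] have "f x \<bullet> x / (norm x)\<^sup>2 \<le> l"
      by (simp add: f.scaleR l_def power2_eq_square)
    then show ?thesis using False by (simp add: field_simps dot_square_norm)
  qed (simp add: f.zero)
  have "w = 0"
  proof (rule ccontr)
    assume "w \<noteq> 0"
    then have a: "0 < w \<bullet> w" by simp
    define b where "b = l * (w \<bullet> w) - f w \<bullet> w"
    have *: "2 * t * (w \<bullet> w) \<le> t\<^sup>2 * b" for t :: real
    proof -
      have "f (v + t *\<^sub>R w) \<bullet> (v + t *\<^sub>R w) = l + 2 * t * (w \<bullet> f v) + t\<^sup>2 * (f w \<bullet> w)"
        using adj[of w v] by (simp add: f.add f.scaleR inner_add_left inner_add_right l_def
            inner_commute power2_eq_square algebra_simps)
      moreover have "(v + t *\<^sub>R w) \<bullet> (v + t *\<^sub>R w) = 1 + t\<^sup>2 * (w \<bullet> w)"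
        using wv by (simp add: inner_add_left inner_add_right vv inner_commute power2_eq_square)
      moreover have "v + t *\<^sub>R w \<in> V" using v wV V(1) by (simp add: subspace_add subspace_scale)
      ultimately show ?thesis
        using rayleigh[of "v + t *\<^sub>R w"] by (simp add: wfv b_def algebra_simps)
    qed
    (* The left side is linear in t and the right side quadratic, so a small t is contradictory. *)
    have "2 * (w \<bullet> w) * (w \<bullet> w) / (\<bar>b\<bar> + 1) \<le> (w \<bullet> w)\<^sup>2 * (b / (\<bar>b\<bar> + 1)\<^sup>2)"
      using *[of "(w \<bullet> w) / (\<bar>b\<bar> + 1)"] by (simp add: power_divide)
    then have "2 \<le> b / (\<bar>b\<bar> + 1)"
      using a by (simp add: divide_simps power2_eq_square split: if_splits)
    then show False by (simp add: divide_simps split: if_splits)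
  qed
  then show ?thesis using v by (intro bexI[of _ v]) (auto simp: w_def l_def)
qed

text \<open>
  The spectral theorem. The induction runs over invariant subspaces: the orthogonal complement of
  an eigenvector in \<open>V\<close> is again invariant, because \<open>f\<close> is self-adjoint.
\<close>
lemma self_adjoint_orthonormal_eigenbasis_subspace:
  fixes f :: "'a::euclidean_space \<Rightarrow> 'a"
  assumes f: "linear f" and adj: "\<And>x y. f x \<bullet> y = x \<bullet> f y"
  shows "subspace V \<Longrightarrow> (\<And>x. x \<in> V \<Longrightarrow> f x \<in> V) \<Longrightarrow>
    \<exists>B\<subseteq>V. pairwise orthogonal B \<and> (\<forall>b\<in>B. norm b = 1 \<and> f b = (f b \<bullet> b) *\<^sub>R b) \<and> span B = V"
proof (induction "dim V" arbitrary: V rule: less_induct)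
  case (less V)
  show ?case
  proof (cases "V = {0}")
    case True
    then show ?thesis by (intro exI[of _ "{}"]) auto
  next
    case False
    obtain v where v: "v \<in> V" "norm v = 1" "f v = (f v \<bullet> v) *\<^sub>R v"
      using self_adjoint_eigenvector_exists[OF f adj less.prems False] by blast
    have vv: "v \<bullet> v = 1" using v by (simp add: dot_square_norm)
    define W where "W = V \<inter> {x. v \<bullet> x = 0}"
    have W: "subspace W" unfolding W_def
      by (intro subspace_inter less.prems subspace_hyperplane)
    have "v \<notin> W" using vv by (simp add: W_def)
    then have "W \<noteq> V" using v(1) by blast
    then have "W \<subset> V" by (auto simp: W_def)
    then have "dim W < dim V"
      using W less.prems(1) by (metis dim_psubset span_eq_iff)
    moreover have "f x \<in> W" if "x \<in> W" for x
    proof -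
      have "v \<bullet> f x = (f v \<bullet> v) * (v \<bullet> x)" by (metis adj inner_scaleR_left v(3))
      then show ?thesis using that less.prems by (simp add: W_def)
    qed
    ultimately obtain B where B: "B \<subseteq> W" "pairwise orthogonal B"
      "\<forall>b\<in>B. norm b = 1 \<and> f b = (f b \<bullet> b) *\<^sub>R b" "span B = W"
      using less.hyps[OF _ W] by blast
    have "span (insert v B) = V"
    proof
      show "span (insert v B) \<subseteq> V"
        using B(1) v(1) less.prems(1) by (intro span_minimal) (auto simp: W_def)
      show "V \<subseteq> span (insert v B)"
      proof
        fix x assume x: "x \<in> V"
        have "x - (v \<bullet> x) *\<^sub>R v \<in> W"
          using x v(1) less.prems(1) vv
          by (simp add: W_def subspace_diff subspace_scale inner_diff_right)
        then show "x \<in> span (insert v B)" unfolding span_breakdown_eq B(4) by blast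
      qed
    qed
    moreover have "pairwise orthogonal (insert v B)"
      using B(1,2) by (auto simp: pairwise_insert orthogonal_def W_def inner_commute)
    ultimately show ?thesis
      using B v by (intro exI[of _ "insert v B"]) (auto simp: W_def)
  qed
qed

lemma self_adjoint_orthonormal_eigenbasis:
  fixes f :: "'a::euclidean_space \<Rightarrow> 'a"
  assumes "linear f" "\<And>x y. f x \<bullet> y = x \<bullet> f y"
  obtains B where "pairwise orthogonal B" "\<And>b. b \<in> B \<Longrightarrow> norm b = 1"
    "\<And>b. b \<in> B \<Longrightarrow> f b = (f b \<bullet> b) *\<^sub>R b" "span B = UNIV"
  using self_adjoint_orthonormal_eigenbasis_subspace[OF assms, of UNIV] by auto

text \<open>
  The matrix \<open>Q\<close> whose columns are the basis vectors conjugates \<open>f\<close> to a diagonal matrix.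
\<close>
lemma det_matrix_eq_prod_eigenbasis:
  fixes f :: "real^'n \<Rightarrow> real^'n"
  assumes f: "linear f" and B: "pairwise orthogonal B" "\<And>b. b \<in> B \<Longrightarrow> norm b = 1" "span B = UNIV"
    and eig: "\<And>b. b \<in> B \<Longrightarrow> f b = l b *\<^sub>R b"
  shows "det (matrix f) = (\<Prod>b\<in>B. l b)"
proof -
  have ind: "independent B" using B(1) B(2)[of 0] by (intro pairwise_orthogonal_independent) auto
  have "card B = CARD('n)" using ind B(3) by (metis basis_card_eq_dim dim_UNIV DIM_cart DIM_real mult.right_neutral subset_UNIV span_UNIV)
  then obtain h where h: "bij_betw h (UNIV::'n set) B"
    by (metis finite_class.finite_UNIV finite_same_card_bij finiteI_independent ind)
  define Q :: "real^'n^'n" where "Q = (\<chi> i j. h j $ i)"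
  have col: "column j Q = h j" for j by (simp add: Q_def column_def vec_eq_iff)
  have hB: "h j \<in> B" for j using h by (auto simp: bij_betw_def)
  have "h i \<noteq> h j" if "i \<noteq> j" for i j using h that by (auto simp: bij_betw_def inj_on_def)
  then have "orthogonal_matrix Q"
    unfolding orthogonal_matrix_orthonormal_columns col
    using hB B(1,2) by (auto simp: pairwise_def)
  then have Q: "det Q \<noteq> 0" using det_orthogonal_matrix by fastforce
  define L :: "real^'n^'n" where "L = (\<chi> i j. if i = j then l (h j) else 0)"
  have "matrix f ** Q = Q ** L"
  proof -
    have "(matrix f ** Q) $ i $ j = (Q ** L) $ i $ j" for i j
    proof -
      have "(matrix f ** Q) $ i $ j = (matrix f *v h j) $ i"
        by (simp add: matrix_matrix_mult_def matrix_vector_mult_def Q_def)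
      also have "\<dots> = l (h j) * h j $ i"
        using f eig[OF hB] by (simp add: matrix_works linear_matrix_vector_mul_eq)
      also have "\<dots> = (Q ** L) $ i $ j"
        by (simp add: matrix_matrix_mult_def Q_def L_def if_distrib cong: if_cong)
      finally show ?thesis .
    qed
    then show ?thesis by (simp add: vec_eq_iff)
  qed
  then have "det (matrix f) * det Q = det Q * det L" by (metis det_mul)
  then have "det (matrix f) = det L" using Q by simp
  also have "\<dots> = (\<Prod>i\<in>UNIV. L $ i $ i)" by (rule det_diagonal) (simp add: L_def)
  also have "\<dots> = (\<Prod>b\<in>B. l b)"
    using prod.reindex_bij_betw[OF h, of l] by (simp add: L_def)
  finally show ?thesis .
qed

lemma orthonormal_parseval:
  fixes x :: "'a::euclidean_space"
  assumes B: "pairwise orthogonal B" "\<And>b. b \<in> B \<Longrightarrow> norm b = 1" and x: "x \<in> span B"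
  shows "(\<Sum>b\<in>B. (x \<bullet> b)\<^sup>2) = x \<bullet> x"
proof -
  have fin: "finite B" using B(1) by (rule pairwise_orthogonal_imp_finite)
  have "x \<bullet> x = x \<bullet> (\<Sum>b\<in>B. (x \<bullet> b) *\<^sub>R b)"
    by (simp only: orthonormal_basis_expand[OF B x fin])
  then show ?thesis by (simp add: inner_sum_right inner_commute power2_eq_square)
qed

lemma weighted_geometric_le_arithmetic:
  fixes a x :: "'j \<Rightarrow> real"
  assumes J: "finite J" and a: "\<And>j. j \<in> J \<Longrightarrow> 0 \<le> a j" "sum a J = 1" and x: "\<And>j. j \<in> J \<Longrightarrow> 0 < x j"
  shows "(\<Prod>j\<in>J. x j powr a j) \<le> (\<Sum>j\<in>J. a j * x j)"
proof -
  have J0: "J \<noteq> {}" using a(2) by auto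
  obtain i where i: "i \<in> J" "0 < a i"
    using a by (metis less_eq_real_def sum.neutral zero_neq_one)
  have pos: "0 < (\<Sum>j\<in>J. a j * x j)"
    using J i a x by (intro sum_pos2[of _ i]) (auto intro!: mult_nonneg_nonneg less_imp_le[OF x])
  have "(\<Sum>j\<in>J. a j * ln (x j)) \<le> ln (\<Sum>j\<in>J. a j *\<^sub>R x j)"
    using J J0 a x by (intro concave_on_sum[OF _ _ ln_concave]) auto
  then have "exp (\<Sum>j\<in>J. a j * ln (x j)) \<le> (\<Sum>j\<in>J. a j * x j)"
    using pos by (simp add: ln_ge_iff)
  moreover have "exp (\<Sum>j\<in>J. a j * ln (x j)) = (\<Prod>j\<in>J. x j powr a j)"
    unfolding exp_sum[OF J] by (rule prod.cong) (simp_all add: powr_def less_imp_neq[OF x, symmetric])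
  ultimately show ?thesis by simp
qed

text \<open>
  The determinant inequality behind the geometric Brascamp-Lieb inequality. In an eigenbasis \<open>B\<close> the
  eigenvalue at \<open>b\<close> is the average of the weights \<open>d j\<close> with respect to the probability weights
  \<open>(p j \<bullet> b)\<^sup>2\<close>, hence at least the corresponding geometric mean. In the product over \<open>b\<close> the exponents
  of \<open>d j\<close> add up to \<open>p j \<bullet> p j\<close> by Parseval.
\<close>
lemma det_weighted_frame_operator_ge:
  fixes p :: "'j \<Rightarrow> real^'n"
  assumes J: "finite J" and id: "\<And>x. (\<Sum>j\<in>J. (p j \<bullet> x) *\<^sub>R p j) = x"
    and d: "\<And>j. j \<in> J \<Longrightarrow> 0 < d j"
  shows "(\<Prod>j\<in>J. d j powr (p j \<bullet> p j)) \<le> det (matrix (\<lambda>x. \<Sum>j\<in>J. (d j * (p j \<bullet> x)) *\<^sub>R p j))"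
proof -
  define f where "f x = (\<Sum>j\<in>J. (d j * (p j \<bullet> x)) *\<^sub>R p j)" for x
  have f: "linear f"
    unfolding f_def by (intro linearI)
      (simp_all add: inner_add_right sum.distrib scaleR_sum_right algebra_simps)
  have fxy: "f x \<bullet> y = (\<Sum>j\<in>J. d j * (p j \<bullet> x) * (p j \<bullet> y))" for x y
    by (simp add: f_def inner_sum_left)
  have adj: "f x \<bullet> y = x \<bullet> f y" for x y
    by (subst inner_commute[of x], unfold fxy) (simp add: mult.assoc mult.commute[of "p _ \<bullet> x"])
  obtain B where B: "pairwise orthogonal B" "\<And>b. b \<in> B \<Longrightarrow> norm b = 1" "span B = UNIV"
    and eig: "\<And>b. b \<in> B \<Longrightarrow> f b = (f b \<bullet> b) *\<^sub>R b"
    using self_adjoint_orthonormal_eigenbasis[OF f adj] by metis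
  have "(\<Prod>j\<in>J. d j powr (p j \<bullet> p j)) = (\<Prod>j\<in>J. d j powr (\<Sum>b\<in>B. (p j \<bullet> b)\<^sup>2))"
    using orthonormal_parseval[OF B(1,2)] B(3) by simp
  also have "\<dots> = (\<Prod>j\<in>J. \<Prod>b\<in>B. d j powr (p j \<bullet> b)\<^sup>2)"
    using d pairwise_orthogonal_imp_finite[OF B(1)] by (intro prod.cong refl powr_sum) force+
  also have "\<dots> = (\<Prod>b\<in>B. \<Prod>j\<in>J. d j powr (p j \<bullet> b)\<^sup>2)" by (rule prod.swap)
  also have "\<dots> \<le> (\<Prod>b\<in>B. f b \<bullet> b)"
  proof (intro prod_mono conjI)
    fix b assume b: "b \<in> B"
    show "0 \<le> (\<Prod>j\<in>J. d j powr (p j \<bullet> b)\<^sup>2)" by (simp add: prod_nonneg)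
    have "b \<bullet> b = (\<Sum>j\<in>J. (p j \<bullet> b) *\<^sub>R p j) \<bullet> b" by (simp add: id)
    then have "(\<Sum>j\<in>J. (p j \<bullet> b)\<^sup>2) = 1"
      using B(2)[OF b] by (simp add: inner_sum_left power2_eq_square dot_square_norm)
    then have "(\<Prod>j\<in>J. d j powr (p j \<bullet> b)\<^sup>2) \<le> (\<Sum>j\<in>J. (p j \<bullet> b)\<^sup>2 * d j)"
      by (intro weighted_geometric_le_arithmetic J d) auto
    then show "(\<Prod>j\<in>J. d j powr (p j \<bullet> b)\<^sup>2) \<le> f b \<bullet> b"
      by (simp add: fxy power2_eq_square algebra_simps)
  qed
  also have "\<dots> = det (matrix f)"
    using det_matrix_eq_prod_eigenbasis[OF f B eig] by simp
  finally show ?thesis by (simp add: f_def[abs_def])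
qed

section \<open>The Brascamp-Lieb inequality for exponential densities\<close>

abbreviation exp_dens :: "real \<Rightarrow> ennreal" where
  "exp_dens t \<equiv> ennreal (exponential_density 1 t)"

lemma nn_integral_exp_dens: "(\<integral>\<^sup>+t. exp_dens t \<partial>lborel) = 1"
  using prob_space.emeasure_space_1[OF prob_space_exponential_density[of 1]]
  by (simp add: emeasure_density)

lemma nn_integral_std_normal: "(\<integral>\<^sup>+t. ennreal (std_normal_density t) \<partial>lborel) = 1"
  using prob_space.emeasure_space_1[OF prob_space_normal_density[of 1 0]]
  by (simp add: emeasure_density)

lemma prod_std_normal_Basis:
  "(\<Prod>b\<in>Basis. std_normal_density (y \<bullet> b)) = (1 / sqrt (2 * pi)) ^ DIM('a) * exp (- (y \<bullet> y) / 2)"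
  for y :: "'a::euclidean_space"
proof -
  have "(\<Prod>b\<in>Basis. exp (- (y \<bullet> b)\<^sup>2 / 2)) = exp (- (y \<bullet> y) / 2)"
    using euclidean_inner[of y y]
    by (simp add: exp_sum[symmetric] sum_negf sum_divide_distrib[symmetric] power2_eq_square)
  then show ?thesis by (simp only: std_normal_density_def prod.distrib prod_constant)
qed

text \<open>
  The change of variables formula, weakened to the inequality that a transport argument needs:
  the image \<open>g ` S\<close> may be smaller than the whole space.
\<close>
lemma nn_integral_lborel_le_of_change_of_variables:
  fixes g :: "real^'m::{finite,wellorder} \<Rightarrow> real^'m::_" and f :: "real^'m::_ \<Rightarrow> real"
  assumes S: "S \<in> sets lebesgue"
    and der: "\<And>x. x \<in> S \<Longrightarrow> (g has_derivative g' x) (at x)"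
    and inj: "inj_on g S"
    and f: "f \<in> borel_measurable borel" "\<And>y. 0 \<le> f y" "(\<integral>\<^sup>+y. ennreal (f y) \<partial>lborel) < \<infinity>"
    and c: "0 \<le> c"
  shows "(\<integral>\<^sup>+x. ennreal (c * \<bar>det (matrix (g' x))\<bar> * f (g x)) * indicator S x \<partial>lborel)
      \<le> ennreal c * (\<integral>\<^sup>+y. ennreal (f y) \<partial>lborel)"
proof -
  (* The change of variables formula speaks of vector-valued functions, so f is regarded as a map
     to one-dimensional vectors. *)
  define v where "v = (vec :: real \<Rightarrow> real^1)"
  have v: "bounded_linear v"
    unfolding v_def by (intro linear_conv_bounded_linear[THEN iffD1] linearI) (simp_all add: vec_eq_iff)
  have drop: "bounded_linear (\<lambda>x::real^1. x $ 1)" by (rule bounded_linear_vec_nth)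
  have der': "(g has_derivative g' x) (at x within S)" if "x \<in> S" for x
    using der[OF that] by (rule has_derivative_at_withinI)
  have "integrable lborel f" using f by (simp add: integrable_iff_bounded)
  then have "f absolutely_integrable_on UNIV"
    using f(1) by (simp add: set_integrable_def integrable_completion)
  moreover have im: "g ` S \<in> sets lebesgue"
    using der' S by (intro differentiable_image_in_sets_lebesgue) (auto simp: differentiable_on_def differentiable_def)
  ultimately have fS: "f absolutely_integrable_on g ` S" by (rule set_integrable_subset) simp
  then have "(f has_integral integral (g ` S) f) (g ` S)"
    by (simp add: integrable_integral set_lebesgue_integral_eq_integral(1))
  then have nn: "(\<integral>\<^sup>+y. ennreal (f y) * indicator (g ` S) y \<partial>lborel) = ennreal (integral (g ` S) f)"
    using f(2) by (intro nn_integral_has_integral_lebesgue')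
  have vf: "(\<lambda>y. v (f y)) absolutely_integrable_on g ` S"
    using absolutely_integrable_linear[OF fS v] by (simp add: o_def)
  define h where "h x = \<bar>det (matrix (g' x))\<bar> * f (g x)" for x
  have eq: "\<bar>det (matrix (g' x))\<bar> *\<^sub>R v (f (g x)) = v (h x)" for x
    by (simp add: v_def h_def vec_eq_iff)
  have "(\<lambda>x. v (h x)) absolutely_integrable_on S \<and> integral S (\<lambda>x. v (h x)) = integral (g ` S) (\<lambda>y. v (f y))"
    using has_absolute_integral_change_of_variables[OF S der' inj, of "\<lambda>y. v (f y)"
        "integral (g ` S) (\<lambda>y. v (f y))"] vf unfolding eq by simp
  then have "((\<lambda>x. v (h x)) has_integral integral (g ` S) (\<lambda>y. v (f y))) S"
    by (metis integrable_integral set_lebesgue_integral_eq_integral(1))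
  moreover have "integral (g ` S) (\<lambda>y. v (f y)) = v (integral (g ` S) f)"
    using integral_linear[OF _ v, of f "g ` S"] fS by (simp add: o_def set_lebesgue_integral_eq_integral(1))
  ultimately have "((\<lambda>x. v (h x)) has_integral v (integral (g ` S) f)) S" by simp
  from has_integral_linear[OF this drop]
  have "((\<lambda>x. v (h x) $ 1) has_integral v (integral (g ` S) f) $ 1) S"
    by (simp only: o_def)
  then have "((\<lambda>x. c * h x) has_integral c * integral (g ` S) f) S"
    by (intro has_integral_mult_right) (simp add: v_def)
  then have "(\<integral>\<^sup>+x. ennreal (c * h x) * indicator S x \<partial>lborel) = ennreal (c * integral (g ` S) f)"
    using f(2) c by (intro nn_integral_has_integral_lebesgue') (auto simp: h_def)
  also have "\<dots> = ennreal c * (\<integral>\<^sup>+y. ennreal (f y) * indicator (g ` S) y \<partial>lborel)"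
    using c by (simp add: nn ennreal_mult')
  also have "\<dots> \<le> ennreal c * (\<integral>\<^sup>+y. ennreal (f y) \<partial>lborel)"
    by (intro mult_left_mono nn_integral_mono) (auto simp: indicator_def)
  finally show ?thesis by (simp add: h_def mult.assoc)
qed

text \<open>
  The next three facts concern vectors \<open>p j\<close> that decompose the identity as
  \<open>\<Sum>j. p j \<otimes> p j\<close>. The last one says that the synthesis map \<open>t \<mapsto> \<Sum>j. t j *\<^sub>R p j\<close> does not increase
  norms; it is the adjoint of the isometry \<open>x \<mapsto> (p j \<bullet> x)\<^sub>j\<close>.
\<close>
lemma tight_frame_parseval:
  fixes p :: "'j \<Rightarrow> 'a::euclidean_space"
  assumes id: "\<And>x. (\<Sum>j\<in>J. (p j \<bullet> x) *\<^sub>R p j) = x"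
  shows "(\<Sum>j\<in>J. (p j \<bullet> x)\<^sup>2) = x \<bullet> x"
proof -
  have "x \<bullet> x = (\<Sum>j\<in>J. (p j \<bullet> x) *\<^sub>R p j) \<bullet> x" by (simp only: id)
  then show ?thesis by (simp add: inner_sum_left power2_eq_square)
qed

lemma tight_frame_trace:
  fixes p :: "'j \<Rightarrow> 'a::euclidean_space"
  assumes id: "\<And>x. (\<Sum>j\<in>J. (p j \<bullet> x) *\<^sub>R p j) = x"
  shows "(\<Sum>j\<in>J. p j \<bullet> p j) = real DIM('a)"
proof -
  have "(\<Sum>j\<in>J. p j \<bullet> p j) = (\<Sum>j\<in>J. \<Sum>b\<in>Basis. (p j \<bullet> b)\<^sup>2)"
    by (subst euclidean_inner) (simp add: power2_eq_square)
  also have "\<dots> = (\<Sum>b\<in>Basis. \<Sum>j\<in>J. (p j \<bullet> b)\<^sup>2)" by (rule sum.swap)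
  also have "\<dots> = (\<Sum>b\<in>(Basis :: 'a set). 1)"
    by (intro sum.cong refl) (simp add: tight_frame_parseval[OF id])
  finally show ?thesis by simp
qed

lemma tight_frame_synthesis_le:
  fixes p :: "'j \<Rightarrow> 'a::euclidean_space"
  assumes id: "\<And>x. (\<Sum>j\<in>J. (p j \<bullet> x) *\<^sub>R p j) = x"
  defines "y t \<equiv> \<Sum>j\<in>J. t j *\<^sub>R p j"
  shows "y t \<bullet> y t \<le> (\<Sum>j\<in>J. (t j)\<^sup>2)"
proof -
  have "2 * (y t \<bullet> y t) = (\<Sum>j\<in>J. 2 * t j * (p j \<bullet> y t))"
    by (subst (1) y_def) (simp add: inner_sum_left sum_distrib_left mult.assoc)
  also have "\<dots> \<le> (\<Sum>j\<in>J. (t j)\<^sup>2 + (p j \<bullet> y t)\<^sup>2)"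
    by (intro sum_mono sum_squares_bound)
  also have "\<dots> = (\<Sum>j\<in>J. (t j)\<^sup>2) + y t \<bullet> y t"
    by (simp add: sum.distrib tight_frame_parseval[OF id])
  finally show ?thesis by simp
qed

lemma AE_inner_nonzero:
  fixes p :: "'a::euclidean_space"
  assumes "p \<noteq> 0"
  shows "AE x in lborel. p \<bullet> x \<noteq> 0"
proof (rule AE_I')
  have "{x. p \<bullet> x = 0} \<in> null_sets lebesgue"
    using negligible_hyperplane[of p 0] assms by (simp add: negligible_iff_null_sets)
  moreover have "{x. p \<bullet> x = 0} \<in> sets borel" by (intro borel_closed closed_hyperplane)
  ultimately show "{x. p \<bullet> x = 0} \<in> null_sets lborel"
    by (simp add: null_sets_completion_iff)
qed auto

text \<open>
  The geometric Brascamp-Lieb inequality for exponential densities. Put \<open>c j = p j \<bullet> p j\<close>, and let \<open>\<tau>\<close>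
  transport the exponential to the normal law. The map
  \<open>\<Phi> x = (\<Sum>j. sqrt (c j) * \<tau> ((p j \<bullet> x) / c j) *\<^sub>R p j)\<close> is injective on the cone where all \<open>p j \<bullet> x\<close> are
  positive, because it is strictly monotone. Raising the equation
  \<open>exp (- r) = \<phi> (\<tau> r) * \<tau>' r\<close> at \<open>r = (p j \<bullet> x) / c j\<close> to the power \<open>c j\<close> and multiplying over \<open>j\<close>
  expresses the integrand through normal densities and through derivatives of \<open>\<tau>\<close>. The first product
  is at most the Gaussian density at \<open>\<Phi> x\<close>, since synthesis does not increase norms, and the second
  at most the Jacobian of \<open>\<Phi>\<close> times the constant, by the determinant inequality. The integral is then at
  most the constant times the total mass of the Gaussian.
\<close>
theorem brascamp_lieb_exponential:
  fixes p :: "'j \<Rightarrow> real^'m::{finite,wellorder}"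
  assumes J: "finite J" and id: "\<And>x. (\<Sum>j\<in>J. (p j \<bullet> x) *\<^sub>R p j) = x"
    and nz: "\<And>j. j \<in> J \<Longrightarrow> p j \<noteq> 0"
  shows "(\<integral>\<^sup>+x. (\<Prod>j\<in>J. exp_dens (p j \<bullet> x)) \<partial>lborel)
      \<le> ennreal (\<Prod>j\<in>J. (p j \<bullet> p j) powr ((p j \<bullet> p j) / 2))"
proof -
  define c where "c j = p j \<bullet> p j" for j
  define K where "K = (\<Prod>j\<in>J. c j powr (c j / 2))"
  have c: "0 < c j" if "j \<in> J" for j using nz[OF that] by (simp add: c_def)
  obtain \<tau> \<tau>' :: "real \<Rightarrow> real" where D\<tau>: "\<And>r. 0 < r \<Longrightarrow> (\<tau> has_real_derivative \<tau>' r) (at r)"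
    and \<tau>'_pos: "\<And>r. 0 < r \<Longrightarrow> 0 < \<tau>' r"
    and \<tau>: "\<And>r. 0 < r \<Longrightarrow> exp (- r) = std_normal_density (\<tau> r) * \<tau>' r"
    using exponential_to_normal_transport by metis
  have \<tau>_mono: "\<tau> r < \<tau> s" if "0 < r" "r < s" for r s
  proof (rule DERIV_pos_imp_increasing[OF that(2)])
    fix x assume "r \<le> x"
    then have "0 < x" using that(1) by simp
    then show "\<exists>D. (\<tau> has_real_derivative D) (at x) \<and> 0 < D" using D\<tau> \<tau>'_pos by blast
  qed
  define \<Omega> where "\<Omega> = {x. \<forall>j\<in>J. 0 < p j \<bullet> x}"
  define r where "r j x = (p j \<bullet> x) / c j" for j x
  have r: "0 < r j x" if "j \<in> J" "x \<in> \<Omega>" for j x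
    using that c by (auto simp: \<Omega>_def r_def)
  define \<Phi> where "\<Phi> x = (\<Sum>j\<in>J. (sqrt (c j) * \<tau> (r j x)) *\<^sub>R p j)" for x
  define d where "d j x = \<tau>' (r j x) / sqrt (c j)" for j x
  have d: "0 < d j x" if "j \<in> J" "x \<in> \<Omega>" for j x
    using \<tau>'_pos r c that by (simp add: d_def)
  define \<Phi>' where "\<Phi>' x h = (\<Sum>j\<in>J. (d j x * (p j \<bullet> h)) *\<^sub>R p j)" for x h
  define \<gamma> where "\<gamma> y = (\<Prod>b\<in>Basis. std_normal_density (y \<bullet> b))" for y :: "real^'m::_"
  have "open \<Omega>"
  proof -
    have "\<Omega> = (\<Inter>j\<in>J. {x. 0 < p j \<bullet> x})" by (auto simp: \<Omega>_def)
    then show ?thesis using J by (auto intro!: open_INT open_halfspace_gt)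
  qed
  then have \<Omega>: "\<Omega> \<in> sets lebesgue" by (simp add: borel_open)
  have D\<Phi>: "(\<Phi> has_derivative \<Phi>' x) (at x)" if x: "x \<in> \<Omega>" for x
  proof -
    have "((\<lambda>x. (sqrt (c j) * \<tau> (r j x)) *\<^sub>R p j) has_derivative (\<lambda>h. (d j x * (p j \<bullet> h)) *\<^sub>R p j)) (at x)"
      if j: "j \<in> J" for j
    proof -
      have "(r j has_derivative (\<lambda>h. (p j \<bullet> h) / c j)) (at x)"
        unfolding r_def using c[OF j] by (auto intro!: derivative_eq_intros)
      from has_derivative_compose[OF this D\<tau>[OF r[OF j x], unfolded has_field_derivative_def]]
      have "((\<lambda>x. \<tau> (r j x)) has_derivative (\<lambda>h. \<tau>' (r j x) * ((p j \<bullet> h) / c j))) (at x)" .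
      moreover have "sqrt (c j) * (\<tau>' (r j x) * ((p j \<bullet> h) / c j)) = d j x * (p j \<bullet> h)" for h
        using c[OF j] real_sqrt_mult_self[of "c j"] by (simp add: d_def field_simps)
      ultimately show ?thesis
        by (auto intro!: derivative_eq_intros)
    qed
    then show ?thesis unfolding \<Phi>_def \<Phi>'_def by (intro has_derivative_sum)
  qed
  have inj: "inj_on \<Phi> \<Omega>"
  proof (rule inj_onI, rule ccontr)
    fix x y assume x: "x \<in> \<Omega>" and y: "y \<in> \<Omega>" and eq: "\<Phi> x = \<Phi> y" and ne: "x \<noteq> y"
    define s where "s j = sqrt (c j) * (\<tau> (r j x) - \<tau> (r j y)) * (p j \<bullet> x - p j \<bullet> y)" for j
    have s: "0 < s j" if j: "j \<in> J" and "p j \<bullet> x \<noteq> p j \<bullet> y" for j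
    proof (cases "p j \<bullet> x < p j \<bullet> y")
      case True
      then have "r j x < r j y" using c[OF j] by (simp add: r_def divide_strict_right_mono)
      then have "\<tau> (r j x) - \<tau> (r j y) < 0" using \<tau>_mono r x j by simp
      then show ?thesis using True c[OF j] unfolding s_def by (intro mult_neg_neg mult_pos_neg) auto
    next
      case False
      then have "r j y < r j x" using that c[OF j] by (simp add: r_def divide_strict_right_mono)
      then have "0 < \<tau> (r j x) - \<tau> (r j y)" using \<tau>_mono r y j by simp
      then show ?thesis using False that c[OF j] unfolding s_def by (intro mult_pos_pos) auto
    qed
    have "\<exists>j\<in>J. p j \<bullet> x \<noteq> p j \<bullet> y"
    proof (rule ccontr)
      assume "\<not> (\<exists>j\<in>J. p j \<bullet> x \<noteq> p j \<bullet> y)"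
      then have "(\<Sum>j\<in>J. (p j \<bullet> x) *\<^sub>R p j) = (\<Sum>j\<in>J. (p j \<bullet> y) *\<^sub>R p j)"
        by (intro sum.cong) auto
      then show False using ne by (simp only: id)
    qed
    then obtain i where i: "i \<in> J" "p i \<bullet> x \<noteq> p i \<bullet> y" by blast
    have "0 \<le> s j" if "j \<in> J" for j
      using s[OF that] by (cases "p j \<bullet> x = p j \<bullet> y") (simp_all add: s_def)
    then have "0 < (\<Sum>j\<in>J. s j)" using J i s by (intro sum_pos2[of J i]) auto
    moreover have "(\<Sum>j\<in>J. s j) = (\<Phi> x - \<Phi> y) \<bullet> (x - y)"
      unfolding \<Phi>_def s_def sum_subtractf[symmetric] scaleR_diff_left[symmetric] inner_sum_left
      by (intro sum.cong refl) (simp add: inner_diff_right algebra_simps)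
    ultimately show False by (simp add: eq)
  qed
  have \<gamma>_meas: "\<gamma> \<in> borel_measurable borel" unfolding \<gamma>_def by measurable
  have \<gamma>_nonneg: "0 \<le> \<gamma> y" for y by (simp add: \<gamma>_def prod_nonneg)
  have \<gamma>_int: "(\<integral>\<^sup>+y. ennreal (\<gamma> y) \<partial>lborel) = 1"
  proof -
    have "(\<integral>\<^sup>+y. ennreal (\<gamma> y) \<partial>lborel)
        = (\<integral>\<^sup>+y. (\<Prod>b\<in>(Basis :: (real^'m::_) set). ennreal (std_normal_density (y \<bullet> b))) \<partial>lborel)"
      by (simp add: \<gamma>_def prod_ennreal)
    also have "\<dots> = (\<Prod>b\<in>(Basis :: (real^'m::_) set). \<integral>\<^sup>+t. ennreal (std_normal_density t) \<partial>lborel)"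
      by (rule nn_integral_lborel_prod) auto
    finally show ?thesis by (simp add: nn_integral_std_normal)
  qed
  have K: "0 \<le> K" by (simp add: K_def prod_nonneg)
  have pointwise: "(\<Prod>j\<in>J. exp (- (p j \<bullet> x))) \<le> K * \<bar>det (matrix (\<Phi>' x))\<bar> * \<gamma> (\<Phi> x)"
    if x: "x \<in> \<Omega>" for x
  proof -
    have factor: "exp (- (p j \<bullet> x)) = c j powr (c j / 2) * d j x powr c j *
        ((1 / sqrt (2 * pi)) powr c j * exp (- (sqrt (c j) * \<tau> (r j x))\<^sup>2 / 2))"
      if j: "j \<in> J" for j
    proof -
      have "exp (- (p j \<bullet> x)) = exp (- r j x) powr c j"
        using c[OF j] by (simp add: powr_def r_def)
      also have "exp (- r j x) = sqrt (c j) * d j x * (1 / sqrt (2 * pi) * exp (- (\<tau> (r j x))\<^sup>2 / 2))"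
        using \<tau>[OF r[OF j x]] c[OF j] by (simp add: d_def std_normal_density_def)
      also have "\<dots> powr c j = sqrt (c j) powr c j * d j x powr c j *
          ((1 / sqrt (2 * pi)) powr c j * exp (- (\<tau> (r j x))\<^sup>2 / 2) powr c j)"
        using c[OF j] d[OF j x] by (simp only: powr_mult)
      also have "sqrt (c j) powr c j = c j powr (c j / 2)"
        using c[OF j] by (simp add: powr_half_sqrt[symmetric] powr_powr)
      also have "exp (- (\<tau> (r j x))\<^sup>2 / 2) powr c j = exp (- (sqrt (c j) * \<tau> (r j x))\<^sup>2 / 2)"
        using c[OF j] by (simp add: powr_def power_mult_distrib)
      finally show ?thesis .
    qed
    have "(\<Prod>j\<in>J. (1 / sqrt (2 * pi)) powr c j * exp (- (sqrt (c j) * \<tau> (r j x))\<^sup>2 / 2))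
        = (1 / sqrt (2 * pi)) powr (\<Sum>j\<in>J. c j) * exp (- (\<Sum>j\<in>J. (sqrt (c j) * \<tau> (r j x))\<^sup>2) / 2)"
      using J by (simp add: prod.distrib powr_sum exp_sum[symmetric] sum_negf sum_divide_distrib)
    also have "\<dots> \<le> (1 / sqrt (2 * pi)) powr (\<Sum>j\<in>J. c j) * exp (- (\<Phi> x \<bullet> \<Phi> x) / 2)"
      using tight_frame_synthesis_le[OF id, of "\<lambda>j. sqrt (c j) * \<tau> (r j x)"]
      by (intro mult_left_mono) (simp_all add: \<Phi>_def)
    also have "\<dots> = \<gamma> (\<Phi> x)"
      unfolding \<gamma>_def prod_std_normal_Basis c_def tight_frame_trace[OF id]
      by (simp add: powr_realpow)
    finally have gauss: "(\<Prod>j\<in>J. (1 / sqrt (2 * pi)) powr c j * exp (- (sqrt (c j) * \<tau> (r j x))\<^sup>2 / 2))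
        \<le> \<gamma> (\<Phi> x)" .
    have det: "(\<Prod>j\<in>J. d j x powr c j) \<le> \<bar>det (matrix (\<Phi>' x))\<bar>"
    proof -
      have "(\<Prod>j\<in>J. d j x powr c j) \<le> det (matrix (\<Phi>' x))"
        unfolding c_def \<Phi>'_def[abs_def] using d x by (intro det_weighted_frame_operator_ge J id)
      then show ?thesis by simp
    qed
    have "(\<Prod>j\<in>J. exp (- (p j \<bullet> x))) = K * (\<Prod>j\<in>J. d j x powr c j) *
        (\<Prod>j\<in>J. (1 / sqrt (2 * pi)) powr c j * exp (- (sqrt (c j) * \<tau> (r j x))\<^sup>2 / 2))"
      unfolding K_def prod.distrib[symmetric] using factor by (intro prod.cong) (simp_all add: mult.assoc)
    also have "\<dots> \<le> K * \<bar>det (matrix (\<Phi>' x))\<bar> * \<gamma> (\<Phi> x)"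
      using gauss det K by (intro mult_mono mult_nonneg_nonneg prod_nonneg) auto
    finally show ?thesis .
  qed
  have "(\<integral>\<^sup>+x. (\<Prod>j\<in>J. exp_dens (p j \<bullet> x)) \<partial>lborel)
      \<le> (\<integral>\<^sup>+x. ennreal (K * \<bar>det (matrix (\<Phi>' x))\<bar> * \<gamma> (\<Phi> x)) * indicator \<Omega> x \<partial>lborel)"
  proof (rule nn_integral_mono_AE)
    (* The boundary of the cone, where a factor of the integrand jumps and the transport is undefined,
       has measure 0. *)
    have "AE x in lborel. \<forall>j\<in>J. p j \<bullet> x \<noteq> 0"
      using J nz by (intro AE_finite_allI AE_inner_nonzero)
    then show "AE x in lborel. (\<Prod>j\<in>J. exp_dens (p j \<bullet> x))
        \<le> ennreal (K * \<bar>det (matrix (\<Phi>' x))\<bar> * \<gamma> (\<Phi> x)) * indicator \<Omega> x"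
    proof eventually_elim
      case (elim x)
      show ?case
      proof (cases "x \<in> \<Omega>")
        case True
        then have "(\<Prod>j\<in>J. exp_dens (p j \<bullet> x)) = (\<Prod>j\<in>J. ennreal (exp (- (p j \<bullet> x))))"
          by (intro prod.cong) (auto simp: exponential_density_def \<Omega>_def)
        also have "\<dots> = ennreal (\<Prod>j\<in>J. exp (- (p j \<bullet> x)))" by (simp add: prod_ennreal)
        finally show ?thesis using pointwise[OF True] True by (simp add: ennreal_leI)
      next
        case False
        then obtain j where "j \<in> J" "p j \<bullet> x < 0" using elim by (force simp: \<Omega>_def)
        then have "(\<Prod>j\<in>J. exp_dens (p j \<bullet> x)) = 0"
          using J by (intro prod_zero) (auto simp: exponential_density_def)
        then show ?thesis by (simp only: zero_le)
      qed
    qed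
  qed
  also have "\<dots> \<le> ennreal K * (\<integral>\<^sup>+y. ennreal (\<gamma> y) \<partial>lborel)"
    by (intro nn_integral_lborel_le_of_change_of_variables \<Omega> D\<Phi> inj \<gamma>_meas \<gamma>_nonneg K) (simp_all add: \<gamma>_int)
  finally show ?thesis by (simp add: \<gamma>_int K_def c_def)
qed

section \<open>Exponential integrals over cones in subspaces\<close>

lemma distr_PiM_lborel_reindex:
  fixes h :: "'b \<Rightarrow> 'a"
  assumes D: "finite D" and h: "bij_betw h D A"
  shows "distr (\<Pi>\<^sub>M a\<in>A. (lborel :: real measure)) (\<Pi>\<^sub>M b\<in>D. lborel) (\<lambda>f. \<lambda>b\<in>D. f (h b))
      = (\<Pi>\<^sub>M b\<in>D. lborel)" (is "?R = ?P")
proof -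
  have A: "finite A" using D h bij_betw_finite by blast
  have hA: "h b \<in> A" if "b \<in> D" for b using h that by (auto simp: bij_betw_def)
  interpret D: product_sigma_finite "\<lambda>_::'b. lborel :: real measure" by standard
  interpret A: product_sigma_finite "\<lambda>_::'a. lborel :: real measure" by standard
  have meas: "(\<lambda>f. \<lambda>b\<in>D. f (h b)) \<in> (\<Pi>\<^sub>M a\<in>A. (lborel :: real measure)) \<rightarrow>\<^sub>M ?P"
    by (rule measurable_restrict[where X = "\<lambda>b f. f (h b)"]) (simp add: hA)
  show ?thesis
  proof (rule D.PiM_eqI[OF D])
    fix X :: "'b \<Rightarrow> real set" assume X: "\<And>b. b \<in> D \<Longrightarrow> X b \<in> sets lborel"
    let ?Y = "\<lambda>a. X (inv_into D h a)"
    have inv: "inv_into D h (h b) = b" if "b \<in> D" for b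
      using h that by (intro inv_into_f_f) (auto simp: bij_betw_def)
    have YA: "?Y a \<in> sets lborel" if "a \<in> A" for a
      using h that X by (auto simp: bij_betw_def inv_into_into)
    have eq: "(\<lambda>f. \<lambda>b\<in>D. f (h b)) -` Pi\<^sub>E D X \<inter> space (\<Pi>\<^sub>M a\<in>A. (lborel :: real measure)) = Pi\<^sub>E A ?Y"
    proof (intro set_eqI iffI)
      fix f assume f: "f \<in> (\<lambda>f. \<lambda>b\<in>D. f (h b)) -` Pi\<^sub>E D X \<inter> space (\<Pi>\<^sub>M a\<in>A. (lborel :: real measure))"
      have "f a \<in> ?Y a" if "a \<in> A" for a
      proof -
        have b: "inv_into D h a \<in> D" "h (inv_into D h a) = a"
          using h that by (auto simp: bij_betw_def inv_into_into f_inv_into_f)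
        then show ?thesis using f PiE_mem[of "\<lambda>b\<in>D. f (h b)" D X "inv_into D h a"] by simp
      qed
      then show "f \<in> Pi\<^sub>E A ?Y" using f by (simp add: space_PiM PiE_iff)
    next
      fix f assume f: "f \<in> Pi\<^sub>E A ?Y"
      have "f (h b) \<in> X b" if "b \<in> D" for b
        using PiE_mem[OF f hA[OF that]] by (simp add: inv[OF that])
      then show "f \<in> (\<lambda>f. \<lambda>b\<in>D. f (h b)) -` Pi\<^sub>E D X \<inter> space (\<Pi>\<^sub>M a\<in>A. (lborel :: real measure))"
        using f by (simp add: space_PiM PiE_iff)
    qed
    have "emeasure ?R (Pi\<^sub>E D X) = emeasure (\<Pi>\<^sub>M a\<in>A. (lborel :: real measure)) (Pi\<^sub>E A ?Y)"
      using X D meas by (subst emeasure_distr) (auto simp: eq intro!: sets_PiM_I_finite)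
    also have "\<dots> = (\<Prod>a\<in>A. emeasure lborel (?Y a))"
      using YA by (rule A.emeasure_PiM[OF A])
    also have "\<dots> = (\<Prod>b\<in>D. emeasure lborel (?Y (h b)))"
      by (rule prod.reindex_bij_betw[OF h, symmetric])
    also have "\<dots> = (\<Prod>b\<in>D. emeasure lborel (X b))" by (simp add: inv)
    finally show "emeasure ?R (Pi\<^sub>E D X) = (\<Prod>b\<in>D. emeasure lborel (X b))" .
  qed simp
qed

text \<open>
  Scaling of the Lebesgue measure on the span of \<open>B\<close>, in coordinates with respect to \<open>B\<close>. The
  induction peels off one basis vector, so it needs all integrands \<open>G\<close> at once.
\<close>
lemma nn_integral_PiM_lborel_scale:
  fixes B :: "'a::euclidean_space set"
  assumes "finite B" and "G \<in> borel_measurable borel" and l: "0 < l"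
  shows "(\<integral>\<^sup>+f. G (\<Sum>b\<in>B. f b *\<^sub>R b) \<partial>(\<Pi>\<^sub>M b\<in>B. (lborel :: real measure)))
      = ennreal l ^ card B * (\<integral>\<^sup>+f. G (l *\<^sub>R (\<Sum>b\<in>B. f b *\<^sub>R b)) \<partial>(\<Pi>\<^sub>M b\<in>B. (lborel :: real measure)))"
  using assms(1,2)
proof (induction B arbitrary: G rule: finite_induct)
  case (insert a B)
  interpret product_sigma_finite "\<lambda>_::'a. lborel :: real measure" by standard
  note [measurable] = insert.prems
  have upd: "(\<Sum>b\<in>insert a B. (f(a := t)) b *\<^sub>R b) = t *\<^sub>R a + (\<Sum>b\<in>B. f b *\<^sub>R b)" for f :: "'a \<Rightarrow> real" and t
  proof -
    have "(\<Sum>b\<in>B. (f(a := t)) b *\<^sub>R b) = (\<Sum>b\<in>B. f b *\<^sub>R b)"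
      using insert.hyps by (intro sum.cong) auto
    then show ?thesis using insert.hyps by simp
  qed
  have split: "(\<integral>\<^sup>+f. F (\<Sum>b\<in>insert a B. f b *\<^sub>R b) \<partial>(\<Pi>\<^sub>M b\<in>insert a B. (lborel :: real measure)))
      = (\<integral>\<^sup>+t. \<integral>\<^sup>+f. F (t *\<^sub>R a + (\<Sum>b\<in>B. f b *\<^sub>R b)) \<partial>(\<Pi>\<^sub>M b\<in>B. (lborel :: real measure)) \<partial>lborel)"
    if [measurable]: "F \<in> borel_measurable borel" for F :: "'a \<Rightarrow> ennreal"
    using insert.hyps by (subst product_nn_integral_insert_rev) (simp_all add: upd del: fun_upd_apply sum.insert)
  have inner: "(\<integral>\<^sup>+f. G (t *\<^sub>R a + (\<Sum>b\<in>B. f b *\<^sub>R b)) \<partial>(\<Pi>\<^sub>M b\<in>B. (lborel :: real measure)))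
      = ennreal l ^ card B * (\<integral>\<^sup>+f. G (t *\<^sub>R a + l *\<^sub>R (\<Sum>b\<in>B. f b *\<^sub>R b)) \<partial>(\<Pi>\<^sub>M b\<in>B. (lborel :: real measure)))" for t
    by (rule insert.IH[of "\<lambda>y. G (t *\<^sub>R a + y)"]) measurable
  interpret B: finite_product_sigma_finite "\<lambda>_::'a. lborel :: real measure" B
    by standard (rule insert.hyps)
  have meas: "(\<lambda>t. \<integral>\<^sup>+f. G (t *\<^sub>R a + l *\<^sub>R (\<Sum>b\<in>B. f b *\<^sub>R b)) \<partial>(\<Pi>\<^sub>M b\<in>B. (lborel :: real measure))) \<in> borel_measurable borel"
    by measurable
  have "(\<integral>\<^sup>+f. G (\<Sum>b\<in>insert a B. f b *\<^sub>R b) \<partial>(\<Pi>\<^sub>M b\<in>insert a B. (lborel :: real measure)))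
      = ennreal l ^ card B * (\<integral>\<^sup>+t. \<integral>\<^sup>+f. G (t *\<^sub>R a + l *\<^sub>R (\<Sum>b\<in>B. f b *\<^sub>R b)) \<partial>(\<Pi>\<^sub>M b\<in>B. (lborel :: real measure)) \<partial>lborel)"
    using meas by (simp add: split[OF insert.prems] inner nn_integral_cmult)
  also have "\<dots> = ennreal l ^ card B * (ennreal l * (\<integral>\<^sup>+t. \<integral>\<^sup>+f. G ((l * t) *\<^sub>R a + l *\<^sub>R (\<Sum>b\<in>B. f b *\<^sub>R b)) \<partial>(\<Pi>\<^sub>M b\<in>B. (lborel :: real measure)) \<partial>lborel))"
    using nn_integral_real_affine[OF meas, of l 0] l by simp
  also have "\<dots> = ennreal l ^ card (insert a B) * (\<integral>\<^sup>+f. G (l *\<^sub>R (\<Sum>b\<in>insert a B. f b *\<^sub>R b)) \<partial>(\<Pi>\<^sub>M b\<in>insert a B. (lborel :: real measure)))"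
    using insert.hyps by (subst split) (simp_all add: scaleR_add_right mult_ac)
  finally show ?case .
qed simp

text \<open>
  The integral of \<open>x \<mapsto> exp (- \<Sum>j. x $ j)\<close> over the cone of nonnegative vectors in \<open>span D\<close>, with respect
  to the Lebesgue measure of this subspace.
\<close>
definition exp_integral :: "(real^'n::finite) set \<Rightarrow> ennreal" where
  "exp_integral D = (\<integral>\<^sup>+y. (\<Prod>j\<in>UNIV. exp_dens (y $ j)) \<partial>frame_lborel 0 D)"

context
  fixes D :: "(real^'n::finite) set"
  assumes orth: "pairwise orthogonal D" and unit: "\<And>b. b \<in> D \<Longrightarrow> norm b = 1"
begin

lemma exp_integral_PiM:
  "exp_integral D = (\<integral>\<^sup>+f. (\<Prod>j\<in>UNIV. exp_dens (\<Sum>b\<in>D. f b * b $ j)) \<partial>(\<Pi>\<^sub>M b\<in>D. (lborel :: real measure)))"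
  unfolding exp_integral_def by (subst nn_integral_frame_lborel[OF orth unit]) simp_all

lemma inner_frame: "b \<in> D \<Longrightarrow> b' \<in> D \<Longrightarrow> b \<bullet> b' = (if b = b' then 1 else 0)"
  using orth unit[of b] by (auto simp: pairwise_def orthogonal_def dot_square_norm)

text \<open>
  The projections of the standard basis vectors to \<open>span D\<close> decompose the identity of \<open>span D\<close>; the
  one with index \<open>j\<close> has squared norm \<open>\<Sum>b\<in>D. (b $ j)\<^sup>2\<close>. To work in a space of vectors with
  well-ordered coordinates, \<open>D\<close> is identified by \<open>h\<close> with a part \<open>A\<close> of the standard basis of
  \<open>\<real>\<^bsup>2N\<^esup>\<close>. The basis vectors outside \<open>A\<close> are added to the decomposition; each of them contributes a
  factor \<open>1\<close> on both sides. Here \<open>N\<close> is the dimension of the ambient space.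
\<close>
lemma exp_integral_le:
  assumes pos: "\<And>j. 0 < (\<Sum>b\<in>D. (b $ j)\<^sup>2)"
  shows "exp_integral D \<le> ennreal (\<Prod>j\<in>UNIV. (\<Sum>b\<in>D. (b $ j)\<^sup>2) powr ((\<Sum>b\<in>D. (b $ j)\<^sup>2) / 2))"
proof -
  let ?c = "\<lambda>j. \<Sum>b\<in>D. (b $ j)\<^sup>2"
  let ?E = "Basis :: (real^('n bit0)) set"
  interpret product_sigma_finite "\<lambda>_::real^('n bit0). lborel :: real measure" by standard
  have D: "finite D" by (rule frame_finite[OF orth unit])
  have "card D \<le> CARD('n)"
    using independent_bound[OF frame_independent[OF orth unit]] by simp
  then have "card D \<le> card ?E" by simp
  then obtain A where A: "A \<subseteq> ?E" "card A = card D"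
    by (meson obtain_subset_with_card_n)
  have finA: "finite A" using A(1) finite_Basis finite_subset by blast
  obtain h where h: "bij_betw h D A"
    using finite_same_card_bij[OF D finA] A(2) by auto
  have hA: "h b \<in> A" if "b \<in> D" for b using h that by (auto simp: bij_betw_def)
  have inner_h: "h b \<bullet> h b' = (if b = b' then 1 else 0)" if "b \<in> D" "b' \<in> D" for b b'
  proof -
    have "h b \<in> ?E" "h b' \<in> ?E" using hA A(1) that by auto
    moreover have "h b = h b' \<longleftrightarrow> b = b'" using h that by (auto simp: bij_betw_def inj_on_def)
    ultimately show ?thesis by (simp add: inner_Basis)
  qed
  define P where "P j = (\<Sum>b\<in>D. (b $ j) *\<^sub>R h b)" for j
  define J where "J = (UNIV :: 'n set) <+> (?E - A)"
  define q where "q i = (case i of Inl j \<Rightarrow> P j | Inr e \<Rightarrow> e)" for i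
  have sumJ: "(\<Sum>i\<in>J. F i) = (\<Sum>j\<in>UNIV. F (Inl j)) + (\<Sum>e\<in>?E - A. F (Inr e))" for F :: "_ \<Rightarrow> real^('n bit0)"
    unfolding J_def by (subst sum.Plus) simp_all
  have prodJ: "(\<Prod>i\<in>J. F i) = (\<Prod>j\<in>UNIV. F (Inl j)) * (\<Prod>e\<in>?E - A. F (Inr e))" for F :: "_ \<Rightarrow> 'c::comm_monoid_mult"
    unfolding J_def by (subst prod.Plus) simp_all
  have PP: "P j \<bullet> P j = ?c j" for j
    using D by (simp add: P_def inner_sum_left inner_sum_right inner_h power2_eq_square if_distrib cong: if_cong sum.cong)
  have Px: "P j \<bullet> x = (\<Sum>b\<in>D. b $ j * (h b \<bullet> x))" for j x
    by (simp add: P_def inner_sum_left)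
  have id: "(\<Sum>i\<in>J. (q i \<bullet> x) *\<^sub>R q i) = x" for x
  proof -
    have "(\<Sum>j\<in>UNIV. (P j \<bullet> x) *\<^sub>R P j)
        = (\<Sum>j\<in>UNIV. \<Sum>b'\<in>D. \<Sum>b\<in>D. ((h b \<bullet> x) * (b $ j * b' $ j)) *\<^sub>R h b')"
      unfolding Px by (subst P_def) (simp add: scaleR_sum_right sum_distrib_left sum_distrib_right scaleR_sum_left mult_ac)
    also have "\<dots> = (\<Sum>b'\<in>D. \<Sum>b\<in>D. \<Sum>j\<in>UNIV. ((h b \<bullet> x) * (b $ j * b' $ j)) *\<^sub>R h b')"
      by (subst sum.swap, intro sum.cong refl, rule sum.swap)
    also have "\<dots> = (\<Sum>b'\<in>D. \<Sum>b\<in>D. ((h b \<bullet> x) * (b \<bullet> b')) *\<^sub>R h b')"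
      by (simp add: inner_vec_def sum_distrib_left scaleR_sum_left)
    also have "\<dots> = (\<Sum>b\<in>D. (h b \<bullet> x) *\<^sub>R h b)"
      using D by (simp add: inner_frame if_distrib if_distribR cong: if_cong sum.cong)
    also have "\<dots> = (\<Sum>e\<in>A. (e \<bullet> x) *\<^sub>R e)"
      by (rule sum.reindex_bij_betw[OF h])
    finally have "(\<Sum>i\<in>J. (q i \<bullet> x) *\<^sub>R q i) = (\<Sum>e\<in>A. (e \<bullet> x) *\<^sub>R e) + (\<Sum>e\<in>?E - A. (e \<bullet> x) *\<^sub>R e)"
      by (simp add: sumJ q_def)
    also have "\<dots> = (\<Sum>e\<in>?E. (x \<bullet> e) *\<^sub>R e)"
      using A(1) by (subst add.commute, subst sum.subset_diff[symmetric]) (simp_all add: inner_commute)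
    finally show ?thesis by (simp add: euclidean_representation)
  qed
  have nz: "q i \<noteq> 0" if "i \<in> J" for i
  proof (cases i)
    case (Inl j)
    then show ?thesis using PP[of j] pos[of j] by (auto simp: q_def)
  next
    case (Inr e)
    then show ?thesis using that by (auto simp: q_def J_def)
  qed
  have "(\<integral>\<^sup>+x. (\<Prod>i\<in>J. exp_dens (q i \<bullet> x)) \<partial>lborel) \<le> ennreal (\<Prod>i\<in>J. (q i \<bullet> q i) powr ((q i \<bullet> q i) / 2))"
    using id nz by (intro brascamp_lieb_exponential) (auto simp: J_def)
  also have "(\<Prod>i\<in>J. (q i \<bullet> q i) powr ((q i \<bullet> q i) / 2)) = (\<Prod>j\<in>UNIV. ?c j powr (?c j / 2))"
    by (simp add: prodJ q_def PP inner_Basis)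
  finally have BL: "(\<integral>\<^sup>+x. (\<Prod>i\<in>J. exp_dens (q i \<bullet> x)) \<partial>lborel) \<le> ennreal (\<Prod>j\<in>UNIV. ?c j powr (?c j / 2))" .
  define g where "g u = (\<Prod>j\<in>UNIV. exp_dens (\<Sum>b\<in>D. u b * b $ j))" for u
  have g: "g \<in> borel_measurable (\<Pi>\<^sub>M b\<in>D. (lborel :: real measure))"
    unfolding g_def by measurable
  have reindex: "(\<lambda>f. \<lambda>b\<in>D. f (h b)) \<in> (\<Pi>\<^sub>M a\<in>A. (lborel :: real measure)) \<rightarrow>\<^sub>M (\<Pi>\<^sub>M b\<in>D. lborel)"
    by (rule measurable_restrict[where X = "\<lambda>b f. f (h b)"]) (simp add: hA)
  have coord: "e \<bullet> (\<Sum>e'\<in>?E. f e' *\<^sub>R e') = f e" if "e \<in> ?E" for f e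
    using that by (simp add: inner_sum_right inner_Basis if_distrib cong: if_cong)
  have gh: "g (\<lambda>b\<in>D. f (h b)) = (\<Prod>j\<in>UNIV. exp_dens (\<Sum>b\<in>D. f (h b) * b $ j))" for f
    unfolding g_def by (intro prod.cong refl arg_cong[where f = "\<lambda>t. exp_dens t"] sum.cong) simp
  have gh_meas: "(\<lambda>f. g (\<lambda>b\<in>D. f (h b))) \<in> borel_measurable (\<Pi>\<^sub>M a\<in>I. (lborel :: real measure))" if "A \<subseteq> I" for I
  proof -
    have "(\<lambda>f. f (h b)) \<in> borel_measurable (\<Pi>\<^sub>M a\<in>I. (lborel :: real measure))" if "b \<in> D" for b
      using measurable_component_singleton[of "h b" I "\<lambda>_. lborel :: real measure"] hA[OF that] \<open>A \<subseteq> I\<close>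
      by auto
    then have [measurable]: "(\<lambda>f. \<Sum>b\<in>D. f (h b) * b $ j) \<in> borel_measurable (\<Pi>\<^sub>M a\<in>I. (lborel :: real measure))" for j
      by (intro borel_measurable_sum borel_measurable_times) auto
    show ?thesis unfolding gh by measurable
  qed
  have "(\<integral>\<^sup>+x. (\<Prod>i\<in>J. exp_dens (q i \<bullet> x)) \<partial>lborel)
      = (\<integral>\<^sup>+f. g (\<lambda>b\<in>D. f (h b)) * (\<Prod>e\<in>?E - A. exp_dens (f e)) \<partial>(\<Pi>\<^sub>M e\<in>?E. lborel))"
  proof -
    have "(\<Prod>i\<in>J. exp_dens (q i \<bullet> (\<Sum>e'\<in>?E. f e' *\<^sub>R e'))) = g (\<lambda>b\<in>D. f (h b)) * (\<Prod>e\<in>?E - A. exp_dens (f e))" for f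
    proof -
      have "P j \<bullet> (\<Sum>e'\<in>?E. f e' *\<^sub>R e') = (\<Sum>b\<in>D. f (h b) * b $ j)" for j
        unfolding Px using hA A(1) by (intro sum.cong refl) (subst coord, auto simp: mult.commute)
      then show ?thesis by (simp add: prodJ q_def gh coord)
    qed
    then show ?thesis
      by (subst lborel_eq) (subst nn_integral_distr, simp_all)
  qed
  also have "\<dots> = (\<integral>\<^sup>+f. g (\<lambda>b\<in>D. f (h b)) * (\<Prod>e\<in>?E - A. exp_dens (f e)) \<partial>(\<Pi>\<^sub>M e\<in>A \<union> (?E - A). lborel))"
    using A(1) by (simp add: Un_absorb1)
  also have "\<dots> = (\<integral>\<^sup>+f. \<integral>\<^sup>+f'. g (\<lambda>b\<in>D. f (h b)) * (\<Prod>e\<in>?E - A. exp_dens (f' e)) \<partial>(\<Pi>\<^sub>M e\<in>?E - A. lborel) \<partial>(\<Pi>\<^sub>M a\<in>A. lborel))"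
  proof (subst product_nn_integral_fold)
    show "(\<lambda>f. g (\<lambda>b\<in>D. f (h b)) * (\<Prod>e\<in>?E - A. exp_dens (f e))) \<in> borel_measurable (\<Pi>\<^sub>M e\<in>A \<union> (?E - A). lborel)"
      by (intro borel_measurable_times_ennreal gh_meas borel_measurable_prod_ennreal) auto
    have "g (\<lambda>b\<in>D. merge A (?E - A) (f, f') (h b)) = g (\<lambda>b\<in>D. f (h b))" for f f'
      unfolding gh using hA by simp
    moreover have "(\<Prod>e\<in>?E - A. exp_dens (merge A (?E - A) (f, f') e)) = (\<Prod>e\<in>?E - A. exp_dens (f' e))" for f f'
      by (intro prod.cong) (auto simp: merge_def)
    ultimately show "(\<integral>\<^sup>+f. \<integral>\<^sup>+f'. g (\<lambda>b\<in>D. merge A (?E - A) (f, f') (h b)) * (\<Prod>e\<in>?E - A. exp_dens (merge A (?E - A) (f, f') e)) \<partial>(\<Pi>\<^sub>M e\<in>?E - A. lborel) \<partial>(\<Pi>\<^sub>M a\<in>A. lborel))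
        = (\<integral>\<^sup>+f. \<integral>\<^sup>+f'. g (\<lambda>b\<in>D. f (h b)) * (\<Prod>e\<in>?E - A. exp_dens (f' e)) \<partial>(\<Pi>\<^sub>M e\<in>?E - A. lborel) \<partial>(\<Pi>\<^sub>M a\<in>A. lborel))"
      by simp
  qed (use finA in auto)
  also have "\<dots> = (\<integral>\<^sup>+f. g (\<lambda>b\<in>D. f (h b)) \<partial>(\<Pi>\<^sub>M a\<in>A. lborel))"
  proof -
    have "(\<integral>\<^sup>+f'. (\<Prod>e\<in>?E - A. exp_dens (f' e)) \<partial>(\<Pi>\<^sub>M e\<in>?E - A. lborel)) = 1"
      by (subst product_nn_integral_prod) (simp_all add: nn_integral_exp_dens)
    then show ?thesis by (subst nn_integral_cmult) simp_all
  qed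
  also have "\<dots> = (\<integral>\<^sup>+u. g u \<partial>distr (\<Pi>\<^sub>M a\<in>A. lborel) (\<Pi>\<^sub>M b\<in>D. lborel) (\<lambda>f. \<lambda>b\<in>D. f (h b)))"
    using reindex g by (subst nn_integral_distr) simp_all
  also have "\<dots> = exp_integral D"
    unfolding distr_PiM_lborel_reindex[OF D h] exp_integral_PiM g_def ..
  finally show ?thesis using BL by simp
qed

end

section \<open>The volume of a section as an exponential integral\<close>

lemma sum_one_eq_inner: "(\<Sum>j\<in>UNIV. x $ j) = (\<chi> j. 1) \<bullet> x" for x :: "real^'n::finite"
  by (simp add: inner_vec_def)

lemma closed_regular_simplex: "closed (regular_simplex :: (real^'n::finite) set)"
proof -
  have *: "regular_simplex = {x :: real^'n. (\<chi> j. 1) \<bullet> x = 1} \<inter> (\<Inter>j. {x. 0 \<le> x $ j})"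
    by (auto simp: regular_simplex_def sum_one_eq_inner)
  have "closed {x :: real^'n. 0 \<le> x $ j}" for j :: 'n
    by (intro closed_Collect_le continuous_intros)
  then have "closed (\<Inter>j. {x :: real^'n. 0 \<le> x $ j})" by (intro closed_INT ballI)
  then show ?thesis unfolding * by (intro closed_Int closed_hyperplane)
qed

text \<open>
  Slice the cone of nonnegative vectors of \<open>H\<close> by the hyperplanes of coordinate sum \<open>l\<close>. The slice is
  the section of the simplex scaled by \<open>l\<close>, and the slices are at distance \<open>l / sqrt N\<close> from the origin.
  Integrating \<open>exp (- l)\<close> therefore gives the volume of the section times
  \<open>(1 / sqrt N) * \<integral>l. l ^ (dim H - 1) * exp (- l)\<close>, which is a value of the Gamma function.
\<close>
theorem section_vol_eq_exp_integral:
  fixes H :: "(real^'n::finite) set"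
  assumes H: "subspace H" and centroid: "simplex_centroid \<in> H"
    and D: "pairwise orthogonal D" "\<And>b. b \<in> D \<Longrightarrow> norm b = 1" "span D = H"
  shows "section_vol H = sqrt (real CARD('n)) / fact (dim H - 1) * enn2real (exp_integral D)"
proof -
  define N where "N = real CARD('n)"
  have N: "0 < N" by (simp add: N_def)
  define one :: "real^'n" where "one = (\<chi> j. 1)"
  define w where "w = (1 / sqrt N) *\<^sub>R one"
  define F where "F = H \<inter> {x. one \<bullet> x = 0}"
  define z where "z = (simplex_centroid :: real^'n)"
  have zj: "z $ j = 1 / N" for j by (simp add: z_def simplex_centroid_def N_def)
  have one_N: "one \<bullet> one = N" by (simp add: one_def inner_vec_def N_def)
  have one_H: "one \<in> H"
  proof -
    have "one = N *\<^sub>R z" using N by (simp add: vec_eq_iff one_def zj)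
    then show ?thesis using H centroid by (simp add: z_def subspace_scale)
  qed
  have F: "subspace F" unfolding F_def by (intro subspace_inter H subspace_hyperplane)
  obtain B where B: "B \<subseteq> F" "pairwise orthogonal B" "\<And>b. b \<in> B \<Longrightarrow> norm b = 1" "span B = F" "card B = dim F"
    using orthonormal_basis_subspace[OF F] by metis
  have finB: "finite B" by (rule frame_finite[OF B(2,3)])
  have normw: "norm w = 1" using one_N N by (simp add: w_def norm_eq_sqrt_inner real_sqrt_divide)
  have wB: "w \<notin> B"
  proof
    assume "w \<in> B"
    then have "one \<bullet> w = 0" using B(1) by (auto simp: F_def)
    then show False using one_N N by (simp add: w_def)
  qed
  have wF: "orthogonal w b" if "b \<in> B" for b
    using B(1) that by (auto simp: F_def w_def orthogonal_def)
  have D': "pairwise orthogonal (insert w B)" "\<And>b. b \<in> insert w B \<Longrightarrow> norm b = 1"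
    using B(2,3) wF normw by (auto simp: pairwise_insert orthogonal_commute)
  have spanD': "span (insert w B) = H"
  proof
    show "span (insert w B) \<subseteq> H"
      using B(1) one_H H by (intro span_minimal) (auto simp: F_def w_def subspace_scale)
    show "H \<subseteq> span (insert w B)"
    proof
      fix x assume x: "x \<in> H"
      have "x - ((one \<bullet> x) / sqrt N) *\<^sub>R w \<in> F"
        using x one_H H N one_N
        by (simp add: F_def w_def subspace_diff subspace_scale inner_diff_right)
      then show "x \<in> span (insert w B)" unfolding span_breakdown_eq B(4) by blast
    qed
  qed
  have dimH: "card B = dim H - 1"
  proof -
    have "dim H = card (insert w B)"
      using frame_independent[OF D'] spanD' by (metis dim_eq_card_independent dim_span)
    then show ?thesis using wB finB by simp
  qed
  have frame: "orthonormal_frame (H \<inter> sum_one_hyperplane) z B"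
    unfolding orthonormal_frame_def
  proof (intro conjI ballI B(2,3))
    show "H \<inter> sum_one_hyperplane = (+) z ` span B"
    proof (intro set_eqI iffI)
      fix x assume x: "x \<in> H \<inter> sum_one_hyperplane"
      then have "x - z \<in> F"
        using centroid H N
        by (simp add: F_def z_def[symmetric] subspace_diff inner_diff_right one_def sum_one_hyperplane_def flip: sum_one_eq_inner)
           (simp add: zj N_def sum_subtractf)
      then show "x \<in> (+) z ` span B" unfolding B(4) by (intro image_eqI[of _ _ "x - z"]) auto
    next
      fix x assume "x \<in> (+) z ` span B"
      then obtain y where y: "y \<in> F" "x = z + y" unfolding B(4) by blast
      then show "x \<in> H \<inter> sum_one_hyperplane"
        using centroid H N
        by (simp add: F_def z_def[symmetric] subspace_add one_def sum_one_hyperplane_def sum.distrib flip: sum_one_eq_inner)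
           (simp add: zj N_def)
    qed
  qed
  let ?P = "\<Pi>\<^sub>M b\<in>B. (lborel :: real measure)"
  let ?S = "regular_simplex :: (real^'n) set"
  define y where "y f = (\<Sum>b\<in>B. f b *\<^sub>R b)" for f :: "real^'n \<Rightarrow> real"
  have y_span: "y f \<in> F" for f
    unfolding y_def B(4)[symmetric] by (intro span_sum span_scale span_base)
  have y_sum: "(\<Sum>j\<in>UNIV. y f $ j) = 0" for f
    using y_span[of f] by (simp add: F_def one_def sum_one_eq_inner)
  have S_meas[measurable]: "?S \<in> sets borel" by (intro borel_closed closed_regular_simplex)
  have y_meas[measurable]: "y \<in> borel_measurable ?P"
    unfolding y_def by measurable
  define V where "V = (\<integral>\<^sup>+f. indicator ?S (z + y f) \<partial>?P)"
  have vol: "section_vol H = enn2real V"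
  proof -
    have HS: "H \<inter> ?S \<in> sets borel"
      by (rule borel_closed[OF closed_Int[OF closed_subspace[OF H] closed_regular_simplex]])
    have "section_vol H = measure (frame_lborel z B) (H \<inter> ?S)"
      unfolding section_vol_def affine_vol_def affine_lborel_eq_frame_lborel[OF frame]
      using HS by (intro measure_completion) (simp add: sets_frame_lborel[OF B(2,3)])
    also have "\<dots> = enn2real (\<integral>\<^sup>+x. indicator (H \<inter> ?S) x \<partial>frame_lborel z B)"
      using HS by (simp add: measure_def sets_frame_lborel[OF B(2,3)])
    also have "(\<integral>\<^sup>+x. indicator (H \<inter> ?S) x \<partial>frame_lborel z B) = (\<integral>\<^sup>+f. indicator (H \<inter> ?S) (z + y f) \<partial>?P)"
      unfolding y_def using HS by (intro nn_integral_frame_lborel[OF B(2,3)]) simp_all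
    also have "\<dots> = V"
    proof -
      have "z + y f \<in> H" for f
        using y_span[of f] centroid H by (simp add: F_def z_def subspace_add)
      then show ?thesis unfolding V_def by (simp add: indicator_def)
    qed
    finally show ?thesis .
  qed
  have slice: "(\<integral>\<^sup>+f. (\<Prod>j\<in>UNIV. exp_dens ((l / N) + y f $ j)) \<partial>?P)
      = ennreal (l ^ card B * exp (- l)) * V" if l: "0 < l" for l
  proof -
    define G where "G x = (\<Prod>j\<in>UNIV. exp_dens (l / N + x $ j))" for x :: "real^'n"
    have G: "G \<in> borel_measurable borel" unfolding G_def by measurable
    have Gl: "G (l *\<^sub>R y f) = ennreal (exp (- l)) * indicator ?S (z + y f)" for f
    proof -
      have lin: "l / N + (l *\<^sub>R y f) $ j = l * ((z + y f) $ j)" for j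
        by (simp add: zj algebra_simps)
      have one: "(\<Sum>j\<in>UNIV. (z + y f) $ j) = 1"
        using N by (simp add: sum.distrib y_sum zj N_def)
      show ?thesis
      proof (cases "\<forall>j. 0 \<le> (z + y f) $ j")
        case True
        then have "G (l *\<^sub>R y f) = (\<Prod>j\<in>UNIV. ennreal (exp (- (l * ((z + y f) $ j)))))"
          unfolding G_def lin using l by (intro prod.cong refl) (simp add: exponential_density_def not_less zero_le_mult_iff del: vector_add_component)
        also have "\<dots> = ennreal (exp (\<Sum>j\<in>UNIV. - (l * ((z + y f) $ j))))"
          by (simp only: prod_ennreal exp_ge_zero exp_sum finite)
        also have "(\<Sum>j\<in>UNIV. - (l * ((z + y f) $ j))) = - l"
          by (simp only: one sum_negf sum_distrib_left[symmetric] mult_1_right)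
        finally show ?thesis using True one by (simp add: regular_simplex_def del: vector_add_component)
      next
        case False
        then obtain j where j: "(z + y f) $ j < 0" by (auto simp: not_le)
        then have "exp_dens (l / N + (l *\<^sub>R y f) $ j) = 0"
          unfolding lin using l by (simp add: exponential_density_def mult_pos_neg del: vector_add_component)
        then have "G (l *\<^sub>R y f) = 0" unfolding G_def by (intro prod_zero) auto
        then show ?thesis using False by (auto simp: regular_simplex_def indicator_def)
      qed
    qed
    have "(\<integral>\<^sup>+f. G (y f) \<partial>?P) = ennreal l ^ card B * (\<integral>\<^sup>+f. G (l *\<^sub>R y f) \<partial>?P)"
      unfolding y_def by (rule nn_integral_PiM_lborel_scale[OF finB G l])
    also have "\<dots> = ennreal l ^ card B * (ennreal (exp (- l)) * V)"
      unfolding Gl V_def by (subst nn_integral_cmult) simp_all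
    finally show ?thesis
      using l by (simp add: G_def ennreal_power ennreal_mult' mult.assoc)
  qed
  have empty: "(\<integral>\<^sup>+f. (\<Prod>j\<in>UNIV. exp_dens ((l / N) + y f $ j)) \<partial>?P) = 0" if l: "l < 0" for l
  proof -
    have "(\<Prod>j\<in>UNIV. exp_dens ((l / N) + y f $ j)) = 0" for f
    proof -
      have "(\<Sum>j\<in>UNIV. (l / N) + y f $ j) = l"
        using N by (simp add: sum.distrib y_sum N_def)
      then have "\<not> (\<forall>j. 0 \<le> l / N + y f $ j)"
        using l sum_nonneg[of UNIV "\<lambda>j. l / N + y f $ j"] by auto
      then show ?thesis by (intro prod_zero) (auto simp: exponential_density_def not_le)
    qed
    then show ?thesis by (simp only: nn_integral_const mult_zero_left)
  qed
  interpret product_sigma_finite "\<lambda>_::real^'n. lborel :: real measure" by standard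
  interpret P: finite_product_sigma_finite "\<lambda>_::real^'n. lborel :: real measure" B
    by standard (rule finB)
  have I_meas[measurable]: "(\<lambda>l. \<integral>\<^sup>+f. (\<Prod>j\<in>UNIV. exp_dens ((l / N) + y f $ j)) \<partial>?P) \<in> borel_measurable borel"
    unfolding y_def sum_component vector_scaleR_component by measurable
  (* The integral depends only on the span, so D may be replaced by a basis adapted to the
     slicing: w is the normal direction of the slices in H. *)
  have "exp_integral D = exp_integral (insert w B)"
    unfolding exp_integral_def using frame_lborel_0_unique[OF D(1,2) D'] D(3) spanD' by simp
  also have "\<dots> = (\<integral>\<^sup>+s. \<integral>\<^sup>+f. (\<Prod>j\<in>UNIV. exp_dens (s / sqrt N + y f $ j)) \<partial>?P \<partial>lborel)"
  proof -
    have "(\<Sum>b\<in>insert w B. (f(w := s)) b * b $ j) = s / sqrt N + y f $ j" for f s j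
    proof -
      have "(\<Sum>b\<in>B. (f(w := s)) b * b $ j) = y f $ j"
        using wB by (auto simp: y_def intro!: sum.cong)
      then show ?thesis using wB finB by (simp add: w_def one_def)
    qed
    moreover have "exp_integral (insert w B)
        = (\<integral>\<^sup>+f. (\<Prod>j\<in>UNIV. exp_dens (\<Sum>b\<in>insert w B. f b * b $ j)) \<partial>(\<Pi>\<^sub>M b\<in>insert w B. (lborel :: real measure)))"
      by (rule exp_integral_PiM[OF D'])
    ultimately show ?thesis
      using product_nn_integral_insert_rev[OF finB wB,
        of "\<lambda>f. \<Prod>j\<in>UNIV. exp_dens (\<Sum>b\<in>insert w B. f b * b $ j)"]
      by (simp del: fun_upd_apply sum.insert)
  qed
  also have "\<dots> = (\<integral>\<^sup>+s. \<integral>\<^sup>+f. (\<Prod>j\<in>UNIV. exp_dens ((sqrt N * s) / N + y f $ j)) \<partial>?P \<partial>lborel)"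
  proof -
    have "s / sqrt N = (sqrt N * s) / N" for s
      using N real_sqrt_mult_self[of N] by (simp add: field_simps)
    then show ?thesis by simp
  qed
  also have "\<dots> = ennreal (1 / sqrt N) * (\<integral>\<^sup>+l. \<integral>\<^sup>+f. (\<Prod>j\<in>UNIV. exp_dens (l / N + y f $ j)) \<partial>?P \<partial>lborel)"
    using nn_integral_real_affine[OF I_meas, of "sqrt N" 0] N
    by (simp add: mult.assoc[symmetric] ennreal_mult[symmetric])
  also have "(\<integral>\<^sup>+l. \<integral>\<^sup>+f. (\<Prod>j\<in>UNIV. exp_dens (l / N + y f $ j)) \<partial>?P \<partial>lborel)
      = (\<integral>\<^sup>+l. (ennreal (l ^ card B * exp (- l)) * indicator {0..} l) * V \<partial>lborel)"
  proof (rule nn_integral_cong_AE)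
    show "AE l in lborel. (\<integral>\<^sup>+f. (\<Prod>j\<in>UNIV. exp_dens (l / N + y f $ j)) \<partial>?P)
        = (ennreal (l ^ card B * exp (- l)) * indicator {0..} l) * V"
      using AE_lborel_singleton[of "0::real"]
    proof eventually_elim
      case (elim l)
      then show ?case by (cases l "0::real" rule: linorder_cases) (simp_all add: slice empty)
    qed
  qed
  also have "\<dots> = ennreal (fact (card B)) * V"
    by (subst nn_integral_multc) (simp_all add: nn_intergal_power_times_exp_Ici)
  finally have "enn2real (exp_integral D) = 1 / sqrt N * (fact (card B) * enn2real V)"
    using N by (simp add: enn2real_mult)
  then show ?thesis
    using N by (simp add: vol dimH N_def[symmetric])
qed

section \<open>Projections of the vertices\<close>

context
  fixes D :: "(real^'n::finite) set"
  assumes orth: "pairwise orthogonal D" and unit: "\<And>b. b \<in> D \<Longrightarrow> norm b = 1"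
begin

lemma sum_coordinate_squares: "(\<Sum>j\<in>UNIV. \<Sum>b\<in>D. (b $ j)\<^sup>2) = real (card D)"
proof -
  have "(\<Sum>j\<in>UNIV. \<Sum>b\<in>D. (b $ j)\<^sup>2) = (\<Sum>b\<in>D. \<Sum>j\<in>UNIV. (b $ j)\<^sup>2)" by (rule sum.swap)
  also have "\<dots> = (\<Sum>b\<in>D. b \<bullet> b)" by (simp add: inner_vec_def power2_eq_square)
  also have "\<dots> = (\<Sum>b\<in>D. 1)" using unit by (intro sum.cong refl) (simp add: dot_square_norm)
  finally show ?thesis by simp
qed

text \<open>
  Pythagoras: the nearest point of \<open>span D\<close> is the orthogonal projection \<open>q\<close> of the unit vector, and
  the sum on the right is the squared norm of \<open>q\<close>.
\<close>
lemma infdist_axis_span: "(infdist (axis j 1) (span D))\<^sup>2 = 1 - (\<Sum>b\<in>D. (b $ j)\<^sup>2)"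
proof -
  define q where "q = (\<Sum>b\<in>D. (b $ j) *\<^sub>R b)"
  have q: "q \<in> span D" unfolding q_def by (intro span_sum span_scale span_base)
  have D: "finite D" by (rule frame_finite[OF orth unit])
  have qb: "b \<bullet> q = b $ j" if "b \<in> D" for b
    unfolding q_def using that D
    by (simp add: inner_sum_right inner_frame[OF orth unit] if_distrib cong: if_cong sum.cong)
  have perp: "(axis j 1 - q) \<bullet> x = 0" if "x \<in> span D" for x
  proof -
    have "span D \<subseteq> {x. (axis j 1 - q) \<bullet> x = 0}"
    proof (rule span_minimal)
      show "D \<subseteq> {x. (axis j 1 - q) \<bullet> x = 0}"
        using qb by (auto simp: inner_diff_left inner_axis' inner_commute[of q])
    qed (rule subspace_hyperplane)
    then show ?thesis using that by blast
  qed
  have dist: "dist (axis j 1) q \<le> dist (axis j 1) x" if "x \<in> span D" for x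
  proof -
    have "(axis j 1 - q) \<bullet> (q - x) = 0" using that q by (intro perp span_diff)
    then have "(norm ((axis j 1 - q) + (q - x)))\<^sup>2 = (norm (axis j 1 - q))\<^sup>2 + (norm (q - x))\<^sup>2"
      by (intro norm_add_Pythagorean) (simp add: orthogonal_def)
    then have "(norm (axis j 1 - q))\<^sup>2 \<le> (norm (axis j 1 - x))\<^sup>2" by simp
    then show ?thesis unfolding dist_norm by (rule power2_le_imp_le) simp
  qed
  have "infdist (axis j 1) (span D) = dist (axis j 1) q"
  proof (rule antisym)
    show "infdist (axis j 1) (span D) \<le> dist (axis j 1) q" by (rule infdist_le[OF q])
    show "dist (axis j 1) q \<le> infdist (axis j 1) (span D)"
      using q dist by (subst infdist_notempty) (auto intro!: cINF_greatest)
  qed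
  moreover have "(dist (axis j 1) q)\<^sup>2 = (axis j 1 - q) \<bullet> axis j 1 - (axis j 1 - q) \<bullet> q"
    by (simp add: dist_norm dot_square_norm[symmetric] inner_diff_right)
  moreover have "(axis j 1 - q) \<bullet> q = 0" by (rule perp[OF q])
  moreover have "(axis j 1 - q) \<bullet> axis j 1 = 1 - (\<Sum>b\<in>D. (b $ j)\<^sup>2)"
    by (simp add: inner_axis q_def power2_eq_square)
  ultimately show ?thesis by simp
qed

lemma coordinate_squares_le_1: "(\<Sum>b\<in>D. (b $ j)\<^sup>2) \<le> 1"
  using infdist_axis_span[of j] by (smt (verit) zero_le_power2)

text \<open>
  The sum is the squared norm of the projection of the vertex with index \<open>j\<close>. The centroid has norm
  \<open>1 / sqrt N\<close> and inner product \<open>1 / N\<close> with this projection, so Cauchy-Schwarz applies.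
\<close>
lemma coordinate_squares_ge:
  assumes centroid: "simplex_centroid \<in> span D"
  shows "1 / real CARD('n) \<le> (\<Sum>b\<in>D. (b $ j)\<^sup>2)"
proof -
  let ?z = "simplex_centroid :: real^'n"
  have D: "finite D" by (rule frame_finite[OF orth unit])
  have zz: "?z \<bullet> ?z = 1 / real CARD('n)"
    by (simp add: inner_vec_def simplex_centroid_def)
  have "?z = (\<Sum>b\<in>D. (?z \<bullet> b) *\<^sub>R b)"
    by (rule orthonormal_basis_expand[OF orth unit centroid D, symmetric])
  then have "?z $ j = (\<Sum>b\<in>D. (?z \<bullet> b) *\<^sub>R b) $ j" by (rule arg_cong)
  also have "\<dots> = (\<Sum>b\<in>D. (?z \<bullet> b) * b $ j)" by simp
  finally have "(?z $ j)\<^sup>2 \<le> (\<Sum>b\<in>D. (?z \<bullet> b)\<^sup>2) * (\<Sum>b\<in>D. (b $ j)\<^sup>2)"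
    using Cauchy_Schwarz_ineq_sum[of "\<lambda>b. ?z \<bullet> b" "\<lambda>b. b $ j" D] by simp
  also have "(\<Sum>b\<in>D. (?z \<bullet> b)\<^sup>2) = 1 / real CARD('n)"
    using orthonormal_parseval[OF orth unit centroid] zz by simp
  finally show ?thesis by (simp add: simplex_centroid_def power2_eq_square field_simps)
qed

end

section \<open>The extremal subspace\<close>

lemma nn_integral_exp_dens_power:
  assumes M: "0 < M"
  shows "(\<integral>\<^sup>+t. exp_dens (t / sqrt (real M)) ^ M \<partial>lborel) = ennreal (1 / sqrt (real M))"
proof -
  define l where "l = sqrt (real M)"
  have l: "0 < l" "real M = l * l" using M by (simp_all add: l_def)
  have "exp_dens (t / l) ^ M = ennreal (1 / l) * ennreal (exponential_density l t)" for t
  proof (cases "t < 0")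
    case True
    then show ?thesis using l M by (simp add: exponential_density_def divide_neg_pos)
  next
    case False
    have "exp (- (t / l)) ^ M = exp (- t * l)"
      using l by (simp add: exp_of_nat_mult[symmetric])
    then show ?thesis
      using False l by (simp add: exponential_density_def ennreal_power ennreal_mult[symmetric] divide_less_0_iff)
  qed
  then have "(\<integral>\<^sup>+t. exp_dens (t / l) ^ M \<partial>lborel)
      = ennreal (1 / l) * (\<integral>\<^sup>+t. ennreal (exponential_density l t) \<partial>lborel)"
    by (simp add: nn_integral_cmult)
  also have "(\<integral>\<^sup>+t. ennreal (exponential_density l t) \<partial>lborel) = 1"
    using prob_space.emeasure_space_1[OF prob_space_exponential_density[OF l(1)]]
    by (simp add: emeasure_density)
  finally show ?thesis by (simp add: l_def)
qed

text \<open>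
  The extremal subspace: the vectors that are constant on a set \<open>T\<close> of \<open>M\<close> coordinates. In this
  orthonormal basis the integrand is a product of functions of one coordinate each, and only the
  direction \<open>v\<close> of the block contributes a factor other than \<open>1\<close>.
\<close>
lemma block_frame:
  fixes T :: "'n::finite set"
  assumes M: "card T = M" "0 < M"
  defines "v \<equiv> \<chi> j. if j \<in> T then 1 / sqrt (real M) else 0"
  defines "D \<equiv> insert v ((\<lambda>j. axis j (1::real)) ` (- T))"
  shows "pairwise orthogonal D" and "\<And>b. b \<in> D \<Longrightarrow> norm b = 1"
    and "card D = CARD('n) - M + 1" and "simplex_centroid \<in> span D"
    and "(\<Sum>b\<in>D. (b $ j)\<^sup>2) = (if j \<in> T then 1 / real M else 1)"
    and "exp_integral D = ennreal (1 / sqrt (real M))"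
proof -
  define A where "A = (\<lambda>j. axis j (1::real)) ` (- T)"
  have D: "D = insert v A" by (simp add: D_def A_def)
  have inj: "inj_on (\<lambda>j. axis j (1::real)) (- T)" by (auto simp: inj_on_def axis_eq_axis)
  have finA: "finite A" by (simp add: A_def)
  have sM: "0 < sqrt (real M)" "sqrt (real M) * sqrt (real M) = real M" using M(2) by simp_all
  have vv: "v \<bullet> v = 1"
  proof -
    have "v \<bullet> v = (\<Sum>j\<in>UNIV. if j \<in> T then 1 / real M else 0)"
      unfolding v_def inner_vec_def by (intro sum.cong refl) (simp add: sM(2))
    also have "\<dots> = (\<Sum>j\<in>T. 1 / real M)" by (simp add: sum.If_cases)
    finally show ?thesis using M by simp
  qed
  have vA: "orthogonal v b" if "b \<in> A" for b
    using that by (auto simp: A_def orthogonal_def inner_axis v_def)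
  have v_notin: "v \<notin> A" using vA[of v] vv by (auto simp: orthogonal_def)
  show orth: "pairwise orthogonal D"
    unfolding D pairwise_insert using vA
    by (auto simp: orthogonal_commute pairwise_def A_def orthogonal_def inner_axis_axis)
  show unit: "norm b = 1" if "b \<in> D" for b
    using that vv by (auto simp: D A_def norm_eq_sqrt_inner inner_axis_axis)
  show "card D = CARD('n) - M + 1"
    using v_notin finA card_image[OF inj] by (simp add: D A_def Compl_eq_Diff_UNIV card_Diff_subset M(1))
  have sumA: "(\<Sum>b\<in>A. F b) = (\<Sum>i\<in>- T. F (axis i 1))" for F :: "_ \<Rightarrow> 'b::comm_monoid_add"
    unfolding A_def using sum.reindex[OF inj] by simp
  have sumD: "(\<Sum>b\<in>D. F b) = F v + (\<Sum>i\<in>- T. F (axis i 1))" for F :: "_ \<Rightarrow> 'b::comm_monoid_add"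
    using v_notin finA by (simp add: D sumA)
  show "(\<Sum>b\<in>D. (b $ j)\<^sup>2) = (if j \<in> T then 1 / real M else 1)"
    unfolding sumD using sM(2)
    by (simp add: v_def axis_def power2_eq_square if_distrib if_distribR cong: if_cong)
  show "simplex_centroid \<in> span D"
  proof -
    have eq: "simplex_centroid = (sqrt (real M) / real CARD('n)) *\<^sub>R v + (\<Sum>i\<in>- T. (1 / real CARD('n)) *\<^sub>R axis i (1::real))"
      using sM(1) by (auto simp: vec_eq_iff simplex_centroid_def v_def axis_def if_distrib cong: if_cong)
    show ?thesis
      unfolding eq by (intro span_add span_scale span_sum span_base) (auto simp: D A_def)
  qed
  interpret product_sigma_finite "\<lambda>_::real^'n. lborel :: real measure" by standard
  define g where "g b t = (if b = v then exp_dens (t / sqrt (real M)) ^ M else exp_dens t)" for b t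
  have coord: "(\<Sum>b\<in>D. f b * b $ j) = (if j \<in> T then f v / sqrt (real M) else f (axis j 1))" for f j
    unfolding sumD by (simp add: v_def axis_def if_distrib cong: if_cong)
  have gA: "g b = exp_dens" if "b \<in> A" for b using that v_notin by (auto simp: g_def)
  have "(\<Prod>j\<in>UNIV. exp_dens (\<Sum>b\<in>D. f b * b $ j)) = (\<Prod>b\<in>D. g b (f b))" for f
  proof -
    have "(\<Prod>j\<in>UNIV. exp_dens (\<Sum>b\<in>D. f b * b $ j))
        = (\<Prod>j\<in>T. exp_dens (f v / sqrt (real M))) * (\<Prod>j\<in>- T. exp_dens (f (axis j 1)))"
      unfolding coord by (subst prod.subset_diff[of T UNIV]) (simp_all add: Compl_eq_Diff_UNIV mult.commute)
    also have "(\<Prod>j\<in>- T. exp_dens (f (axis j 1))) = (\<Prod>b\<in>A. g b (f b))"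
      using prod.reindex[OF inj, of "\<lambda>b. exp_dens (f b)"] gA by (simp add: A_def)
    finally show ?thesis using v_notin finA by (simp add: D M(1) g_def)
  qed
  then have "exp_integral D = (\<integral>\<^sup>+f. (\<Prod>b\<in>D. g b (f b)) \<partial>(\<Pi>\<^sub>M b\<in>D. (lborel :: real measure)))"
    using exp_integral_PiM[OF orth unit] by simp
  also have "\<dots> = (\<Prod>b\<in>D. \<integral>\<^sup>+t. g b t \<partial>lborel)"
    using finA by (intro product_nn_integral_prod) (simp_all add: D g_def[abs_def])
  also have "\<dots> = (\<integral>\<^sup>+t. g v t \<partial>lborel) * (\<Prod>b\<in>A. \<integral>\<^sup>+t. exp_dens t \<partial>lborel)"
    using v_notin finA gA by (simp add: D)
  also have "\<dots> = ennreal (1 / sqrt (real M))"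
    by (simp add: nn_integral_exp_dens g_def nn_integral_exp_dens_power[OF M(2)])
  finally show "exp_integral D = ennreal (1 / sqrt (real M))" .
qed

section \<open>Sections of the simplex through its centroid\<close>

lemma prod_powr_half_eq_exp:
  fixes c :: "'j \<Rightarrow> real"
  assumes "finite J" "\<And>j. j \<in> J \<Longrightarrow> 0 < c j"
  shows "(\<Prod>j\<in>J. c j powr (c j / 2)) = exp ((\<Sum>j\<in>J. c j * ln (c j)) / 2)"
proof -
  have "(\<Prod>j\<in>J. c j powr (c j / 2)) = (\<Prod>j\<in>J. exp (c j * ln (c j) / 2))"
    using assms(2) by (intro prod.cong refl) (simp add: powr_def less_imp_neq[symmetric])
  then show ?thesis using assms(1) by (simp add: exp_sum sum_divide_distrib)
qed

lemma section_vol_le: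
  fixes H :: "(real^'n::finite) set"
  assumes H: "subspace H" and centroid: "simplex_centroid \<in> H"
    and D: "pairwise orthogonal D" "\<And>b. b \<in> D \<Longrightarrow> norm b = 1" "span D = H"
    and C: "(\<Sum>j\<in>UNIV. (\<Sum>b\<in>D. (b $ j)\<^sup>2) * ln (\<Sum>b\<in>D. (b $ j)\<^sup>2)) \<le> C"
  shows "section_vol H \<le> sqrt (real CARD('n)) / fact (dim H - 1) * exp (C / 2)"
proof -
  have pos: "0 < (\<Sum>b\<in>D. (b $ j)\<^sup>2)" for j
    using coordinate_squares_ge[OF D(1,2), of j] centroid D(3) by (smt (verit) of_nat_0_less_iff zero_less_card_finite zero_less_divide_1_iff)
  have "exp_integral D \<le> ennreal (exp (C / 2))"
    using exp_integral_le[OF D(1,2) pos] C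
    by (simp add: prod_powr_half_eq_exp[OF _ pos]) (meson divide_right_mono ennreal_leI exp_le_cancel_iff order_trans zero_le_numeral)
  then have "enn2real (exp_integral D) \<le> exp (C / 2)"
    by (intro enn2real_leI) auto
  moreover have "section_vol H = sqrt (real CARD('n)) / fact (dim H - 1) * enn2real (exp_integral D)"
    by (rule section_vol_eq_exp_integral[OF H centroid D])
  ultimately show ?thesis by (simp only: mult_left_mono divide_nonneg_nonneg real_sqrt_ge_zero of_nat_0_le_iff fact_ge_zero)
qed

theorem theorem4:
  fixes n k :: nat
  assumes card_n: "CARD('n::finite) = n + 1"
    and k: "1 \<le> k" "k \<le> n + 1"
  shows
    "(\<forall>H :: (real ^ 'n) set. subspace H \<and> dim H = k \<and> simplex_centroid \<in> H \<longrightarrow>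
        section_vol H \<le> sqrt (real (n + 1)) / fact (k - 1)
          * (sqrt (real k) powr (real k / real (n + 1)) / sqrt (real (n + 1))))
     \<and>
     (\<forall>H :: (real ^ 'n) set. subspace H \<and> dim H = k \<and> simplex_centroid \<in> H \<and>
        (\<forall>j. (infdist (axis j 1) H)\<^sup>2 \<le> (real (n + 1) - real k) / (real (n + 2) - real k)) \<longrightarrow>
        section_vol H \<le> sqrt (real (n + 1)) / fact (k - 1)
          * (1 / sqrt (real (n + 2) - real k)))
     \<and>
     (\<exists>H :: (real ^ 'n) set. subspace H \<and> dim H = k \<and> simplex_centroid \<in> H \<and>
        (\<forall>j. (infdist (axis j 1) H)\<^sup>2 \<le> (real (n + 1) - real k) / (real (n + 2) - real k)) \<and>
        section_vol H = sqrt (real (n + 1)) / fact (k - 1)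
          * (1 / sqrt (real (n + 2) - real k)))"
proof (intro conjI allI impI)
  (* M is the size of the block of coordinates in the extremal subspace. *)
  define M where "M = n + 2 - k"
  have M: "0 < M" "real M = real (n + 2) - real k" "M = n + 1 + 1 - k" using k by (auto simp: M_def)
  have bound: "(real (n + 1) - real k) / (real (n + 2) - real k) = 1 - 1 / real M"
  proof -
    have "real (n + 1) - real k = real M - 1" using M(2) by simp
    then show ?thesis unfolding M(2)[symmetric] using M(1) by (simp only: diff_divide_distrib) simp
  qed
  have basis: "\<exists>D. pairwise orthogonal D \<and> (\<forall>b\<in>D. norm b = 1) \<and> span D = H \<and> card D = k"
    if "subspace H" "dim H = k" for H :: "(real^'n) set"
    using orthonormal_basis_subspace[OF that(1)] that(2) by metis
  {
    fix H :: "(real^'n) set"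
    assume H: "subspace H \<and> dim H = k \<and> simplex_centroid \<in> H"
    then obtain D where D: "pairwise orthogonal D" "\<And>b. b \<in> D \<Longrightarrow> norm b = 1" "span D = H" "card D = k"
      using basis by metis
    have "(\<Sum>j\<in>UNIV. (\<Sum>b\<in>D. (b $ j)\<^sup>2) * ln (\<Sum>b\<in>D. (b $ j)\<^sup>2))
        \<le> real k / real (n + 1) * ln (real k) - ln (real (n + 1))"
      using k H coordinate_squares_ge[OF D(1,2)] coordinate_squares_le_1[OF D(1,2)] sum_coordinate_squares[OF D(1,2)]
      by (intro sum_x_ln_x_le_of_sum_eq) (simp_all add: D card_n)
    from section_vol_le[OF _ _ D(1-3) this] H
    have "section_vol H \<le> sqrt (real (n + 1)) / fact (k - 1)
        * exp ((real k / real (n + 1) * ln (real k) - ln (real (n + 1))) / 2)"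
      by (simp add: card_n)
    also have "exp ((real k / real (n + 1) * ln (real k) - ln (real (n + 1))) / 2)
        = sqrt (real k) powr (real k / real (n + 1)) / sqrt (real (n + 1))"
    proof -
      have "exp (ln (real (n + 1)) / 2) = sqrt (real (n + 1))"
        by (simp add: ln_sqrt[symmetric])
      moreover have "exp (real k / real (n + 1) * ln (real k) / 2) = sqrt (real k) powr (real k / real (n + 1))"
        using k by (simp add: powr_def ln_sqrt)
      ultimately show ?thesis by (simp only: diff_divide_distrib exp_diff)
    qed
    finally show "section_vol H \<le> sqrt (real (n + 1)) / fact (k - 1)
          * (sqrt (real k) powr (real k / real (n + 1)) / sqrt (real (n + 1)))" .
  next
    fix H :: "(real^'n) set"
    assume H: "subspace H \<and> dim H = k \<and> simplex_centroid \<in> H \<and>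
        (\<forall>j. (infdist (axis j 1) H)\<^sup>2 \<le> (real (n + 1) - real k) / (real (n + 2) - real k))"
    then obtain D where D: "pairwise orthogonal D" "\<And>b. b \<in> D \<Longrightarrow> norm b = 1" "span D = H" "card D = k"
      using basis by metis
    have low: "1 / real M \<le> (\<Sum>b\<in>D. (b $ j)\<^sup>2)" for j
    proof -
      have "(infdist (axis j 1) H)\<^sup>2 \<le> 1 - 1 / real M" using H by (simp only: bound)
      then show ?thesis using infdist_axis_span[OF D(1,2), of j] by (simp add: D(3))
    qed
    have "(\<Sum>j\<in>UNIV. (\<Sum>b\<in>D. (b $ j)\<^sup>2) * ln (\<Sum>b\<in>D. (b $ j)\<^sup>2)) \<le> - ln (real M)"
      using k M low coordinate_squares_le_1[OF D(1,2)] sum_coordinate_squares[OF D(1,2)]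
      by (intro sum_x_ln_x_le_of_lower_bound[where k = k and N = "n + 1"]) (simp_all add: D card_n)
    from section_vol_le[OF _ _ D(1-3) this] H
    have "section_vol H \<le> sqrt (real (n + 1)) / fact (k - 1) * exp (- ln (real M) / 2)"
      by (simp add: card_n)
    also have "exp (- ln (real M) / 2) = 1 / sqrt (real (n + 2) - real k)"
    proof -
      have "- ln (real M) / 2 = - ln (sqrt (real M))" using M(1) by (simp add: ln_sqrt)
      then have "exp (- ln (real M) / 2) = 1 / sqrt (real M)"
        using M(1) by (simp add: exp_minus inverse_eq_divide)
      then show ?thesis unfolding M(2)[symmetric] .
    qed
    finally show "section_vol H \<le> sqrt (real (n + 1)) / fact (k - 1)
          * (1 / sqrt (real (n + 2) - real k))" .
  }
  have "M \<le> CARD('n)" using k by (simp add: card_n M_def)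
  then obtain T :: "'n set" where T: "card T = M"
    using obtain_subset_with_card_n by metis
  define D where "D = insert (\<chi> j. if j \<in> T then 1 / sqrt (real M) else 0) ((\<lambda>j. axis j (1::real)) ` (- T))"
  note D = block_frame[OF T M(1), folded D_def]
  have "dim (span D) = card D"
    using frame_independent[OF D(1,2)] by (simp add: dim_eq_card_independent)
  then have dim: "dim (span D) = k" using k by (simp add: D(3) card_n M_def)
  have "(infdist (axis j 1) (span D))\<^sup>2 \<le> 1 - 1 / real M" for j
    using infdist_axis_span[OF D(1,2), of j] M(1) by (simp add: D(5))
  moreover have "section_vol (span D) = sqrt (real (n + 1)) / fact (k - 1) * (1 / sqrt (real M))"
    using section_vol_eq_exp_integral[OF subspace_span D(4) D(1,2) refl]
    using dim by (simp add: D(6) card_n)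
  ultimately show "\<exists>H :: (real ^ 'n) set. subspace H \<and> dim H = k \<and> simplex_centroid \<in> H \<and>
        (\<forall>j. (infdist (axis j 1) H)\<^sup>2 \<le> (real (n + 1) - real k) / (real (n + 2) - real k)) \<and>
        section_vol H = sqrt (real (n + 1)) / fact (k - 1)
          * (1 / sqrt (real (n + 2) - real k))"
    unfolding bound using dim D(4) M(2) by (intro exI[of _ "span D"]) simp
qed

end
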